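(* Let $D$ be a $\Delta$-regular bounded open subset of $\mathbb R^d$ whose closure $\overline D$ is contained in some domain (connected open subset) of $\mathbb R^d\setminus\bigcup_{\alpha\in R_+}H_\alpha$. For every $x\in D$, $H_D^{\Delta_k}(x,dy)$ is a probability measure supported by $$\partial D\cup\Big(\bigcup_{\alpha\in R_+}\sigma_\alpha(D)\Big)$$ and satisfies $$ \frac{\sqrt{w_k(x)}}{\sqrt{w_k(y)}}H_D^{\Delta_k}(x,dy)=H_D^{\Delta-q}(x,dy)+\sum_{\alpha\in R_+}\frac{|\alpha|^2k(\alpha)}{\langle y,\alpha\rangle^2}G_D^{\Delta-q}(x,\sigma_\alpha y)\,dy, $$ where $q(x)=\sum_{\alpha\in R_+}\left(\frac{|\alpha|k(\alpha)}{\langle x,\alpha\rangle}\right)^2$ for $x\in D$.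
   Context: Let $d\ge1$, $\langle\cdot,\cdot\rangle$ the Euclidean inner product on $\mathbb R^d$ and $|\cdot|$ its norm. For $\alpha\in\mathbb R^d\setminus\{0\}$, $H_\alpha$ is the hyperplane orthogonal to $\alpha$ and $\sigma_\alpha x=x-2\frac{\langle x,\alpha\rangle}{|\alpha|^2}\alpha$ is the reflection with respect to $H_\alpha$. $R\subset\mathbb R^d\setminus\{0\}$ is a root system (a finite set with $R\cap\mathbb R\alpha=\{\alpha,-\alpha\}$ and $\sigma_\alpha R=R$ for all $\alpha\in R$), $R_+$ is a fixed positive subsystem, and $k:R\to[0,\infty)$ is a multiplicity function (invariant under the group generated by the reflections $\sigma_\alpha$, $\alpha\in R$). The Dunkl Laplacian is $$\Delta_kf(x)=\Delta f(x)+2\sum_{\alpha\in R_+}k(\alpha)\left(\frac{\langle\nabla f(x),\alpha\rangle}{\langle\alpha,x\rangle}-\frac{|\alpha|^2}{2}\frac{f(x)-f(\sigma_\alpha x)}{\langle\alpha,x\rangle^2}\right),\quad f\in C^2(\mathbb R^d),$$ and the invariant weight is $w_k(x)=\prod_{\alpha\in R_+}|\langle x,\alpha\rangle|^{2k(\alpha)}$. $C_c^\infty(D)$ is the space of infinitely differentiable functions with compact support in $D$ (extended by $0$ to $\mathbb R^d$). $D$ is $\Delta$-regular if for every continuous function $g$ on $\partial D$ there is a unique continuous function on $\overline D$ that equals $g$ on $\partial D$ and is harmonic on $D$. For $D$ as in the claim and every continuous $f$ on $\mathbb R^d\setminus D$, there is exactly one continuous function $h:\mathbb R^d\to\mathbb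 R$ with $h=f$ on $\mathbb R^d\setminus D$ and $\int_{\mathbb R^d}h(x)\Delta_k\varphi(x)w_k(x)\,dx=0$ for every $\varphi\in C_c^\infty(D)$; it is denoted $H_D^{\Delta_k}f$. For $x\in D$ the map $f\mapsto H_D^{\Delta_k}f(x)$ defines a positive Radon measure on $\mathbb R^d\setminus D$, denoted $H_D^{\Delta_k}(x,dy)$. For $g$ continuous on $\partial D$, $H_D^{\Delta-q}g$ is the unique continuous function $h$ on $\overline D$ with $h=g$ on $\partial D$ and $\int_D h(x)(\Delta-q)\varphi(x)\,dx=0$ for every $\varphi\in C_c^\infty(D)$; for $x\in D$, $H_D^{\Delta-q}(x,dy)$ is the positive measure on $\partial D$ representing $g\mapsto H_D^{\Delta-q}g(x)$. $G_D^{\Delta-q}$ is the Green potential operator of $\Delta-q$ in $D$: for $g$ bounded Borel on $D$, $G_D^{\Delta-q}g$ is the unique continuous function on $\overline D$, vanishing on $\partial D$, with $\int_D G_D^{\Delta-q}g(x)(\Delta-q)\varphi(x)\,dx=-\int_D g(x)\varphi(x)\,dx$ for every $\varphi\in C_c^\infty(D)$; $G_D^{\Delta-q}(x,y)$ is its kernel (the Green function), so $G_D^{\Delta-q}g(x)=\int_D G_D^{\Delta-q}(x,y)g(y)\,dy$, with $G_D^{\Delta-q}(x,y)=0$ for $y\notin D$ (so the $\alpha$-th term in the sum is a measure carried by $\sigma_\alpha(D)$). "Supported by a set" means that the measure of the complement of that set is zero. *)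

theory Defs
  imports "HOL-Probability.Probability"
begin

section \<open>Root systems\<close>

text \<open>Throughout, a type of class \<open>euclidean_space\<close> plays the role of \<open>\<real>\<^sup>d\<close>; in particular
  the dimension is at least one.\<close>

definition root_hyperplane :: "'a::euclidean_space \<Rightarrow> 'a set" where
  "root_hyperplane \<alpha> = {x. x \<bullet> \<alpha> = 0}"

definition reflection :: "'a::euclidean_space \<Rightarrow> 'a \<Rightarrow> 'a" where
  "reflection \<alpha> x = x - (2 * ((x \<bullet> \<alpha>) / (norm \<alpha>)\<^sup>2)) *\<^sub>R \<alpha>"

definition root_system :: "'a::euclidean_space set \<Rightarrow> bool" where
  "root_system R \<longleftrightarrow> finite R \<and> 0 \<notin> R \<and>
     (\<forall>\<alpha>\<in>R. R \<inter> range (\<lambda>c::real. c *\<^sub>R \<alpha>) = {\<alpha>, - \<alpha>} \<and> reflection \<alpha> ` R = R)"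

definition positive_subsystem :: "'a::euclidean_space set \<Rightarrow> 'a set \<Rightarrow> bool" where
  "positive_subsystem R Rp \<longleftrightarrow>
     (\<exists>\<beta>. (\<forall>\<alpha>\<in>R. \<alpha> \<bullet> \<beta> \<noteq> 0) \<and> Rp = {\<alpha>\<in>R. \<alpha> \<bullet> \<beta> > 0})"

text \<open>Reflections are involutions, so closure under composition with generators already
  yields the generated group.\<close>

inductive_set reflection_group :: "'a::euclidean_space set \<Rightarrow> ('a \<Rightarrow> 'a) set"
  for R :: "'a set" where
  id: "id \<in> reflection_group R"
| comp: "w \<in> reflection_group R \<Longrightarrow> \<alpha> \<in> R \<Longrightarrow> reflection \<alpha> \<circ> w \<in> reflection_group R"

text \<open>Only the values of \<open>k\<close> on \<open>R\<close> are relevant.\<close>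

definition multiplicity_function :: "'a::euclidean_space set \<Rightarrow> ('a \<Rightarrow> real) \<Rightarrow> bool" where
  "multiplicity_function R k \<longleftrightarrow>
     (\<forall>\<alpha>\<in>R. 0 \<le> k \<alpha>) \<and> (\<forall>w\<in>reflection_group R. \<forall>\<alpha>\<in>R. k (w \<alpha>) = k \<alpha>)"


section \<open>Differentiable functions and the Laplacians\<close>

text \<open>\<open>C_k_on n S f\<close> is meant for open \<open>S\<close>: all partial derivatives up to order \<open>n\<close> exist and
  are continuous on \<open>S\<close>.\<close>

primrec C_k_on :: "nat \<Rightarrow> 'a::euclidean_space set \<Rightarrow> ('a \<Rightarrow> real) \<Rightarrow> bool" where
  "C_k_on 0 S f \<longleftrightarrow> continuous_on S f"
| "C_k_on (Suc n) S f \<longleftrightarrow> (\<forall>x\<in>S. f differentiable (at x)) \<and>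
     (\<forall>b\<in>Basis. C_k_on n S (\<lambda>x. frechet_derivative f (at x) b))"

definition test_function :: "'a::euclidean_space set \<Rightarrow> ('a \<Rightarrow> real) \<Rightarrow> bool" where
  "test_function D \<phi> \<longleftrightarrow> (\<forall>n. C_k_on n UNIV \<phi>) \<and>
     compact (closure {x. \<phi> x \<noteq> 0}) \<and> closure {x. \<phi> x \<noteq> 0} \<subseteq> D"

definition laplacian :: "('a::euclidean_space \<Rightarrow> real) \<Rightarrow> 'a \<Rightarrow> real" where
  "laplacian f x =
     (\<Sum>b\<in>Basis. frechet_derivative (\<lambda>y. frechet_derivative f (at y) b) (at x) b)"

definition harmonic_on :: "'a::euclidean_space set \<Rightarrow> ('a \<Rightarrow> real) \<Rightarrow> bool" where
  "harmonic_on D h \<longleftrightarrow> C_k_on 2 D h \<and> (\<forall>x\<in>D. laplacian h x = 0)"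

text \<open>Here \<open>\<langle>\<nabla>f(x), \<alpha>\<rangle>\<close> is \<open>frechet_derivative f (at x) \<alpha>\<close>. On the root hyperplanes, a null set,
  the quotients take the value \<open>0\<close> by the convention for division by zero.\<close>

definition dunkl_laplacian ::
    "'a::euclidean_space set \<Rightarrow> ('a \<Rightarrow> real) \<Rightarrow> ('a \<Rightarrow> real) \<Rightarrow> 'a \<Rightarrow> real" where
  "dunkl_laplacian Rp k f x = laplacian f x +
     2 * (\<Sum>\<alpha>\<in>Rp. k \<alpha> * (frechet_derivative f (at x) \<alpha> / (\<alpha> \<bullet> x)
            - (norm \<alpha>)\<^sup>2 / 2 * ((f x - f (reflection \<alpha> x)) / (\<alpha> \<bullet> x)\<^sup>2)))"

text \<open>As \<open>0 powr 0 = 0\<close>, a factor with \<open>k \<alpha> = 0\<close> is \<open>0\<close> rather than \<open>1\<close> on the hyperplane of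
  \<open>\<alpha>\<close>; this only concerns the root hyperplanes.\<close>

definition dunkl_weight :: "'a::euclidean_space set \<Rightarrow> ('a \<Rightarrow> real) \<Rightarrow> 'a \<Rightarrow> real" where
  "dunkl_weight Rp k x = (\<Prod>\<alpha>\<in>Rp. \<bar>x \<bullet> \<alpha>\<bar> powr (2 * k \<alpha>))"


section \<open>Dirichlet problems\<close>

text \<open>A function on \<open>closure D\<close> is encoded as a function on the whole space that vanishes
  outside \<open>closure D\<close>, so that uniqueness on \<open>closure D\<close> becomes \<open>\<exists>!\<close>.\<close>

definition laplace_regular :: "'a::euclidean_space set \<Rightarrow> bool" where
  "laplace_regular D \<longleftrightarrow>
     (\<forall>g. continuous_on (frontier D) g \<longrightarrow>
        (\<exists>!h. continuous_on (closure D) h \<and> (\<forall>x. x \<notin> closure D \<longrightarrow> h x = 0) \<and>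
              (\<forall>x\<in>frontier D. h x = g x) \<and> harmonic_on D h))"

definition dunkl_dirichlet_solution ::
    "'a::euclidean_space set \<Rightarrow> ('a \<Rightarrow> real) \<Rightarrow> 'a set \<Rightarrow> ('a \<Rightarrow> real) \<Rightarrow> ('a \<Rightarrow> real) \<Rightarrow> bool" where
  "dunkl_dirichlet_solution Rp k D f h \<longleftrightarrow>
     continuous_on UNIV h \<and> (\<forall>x\<in>- D. h x = f x) \<and>
     (\<forall>\<phi>. test_function D \<phi> \<longrightarrow>
        (LINT x|lborel. h x * dunkl_laplacian Rp k \<phi> x * dunkl_weight Rp k x) = 0)"

definition dunkl_dirichlet ::
    "'a::euclidean_space set \<Rightarrow> ('a \<Rightarrow> real) \<Rightarrow> 'a set \<Rightarrow> ('a \<Rightarrow> real) \<Rightarrow> 'a \<Rightarrow> real" where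
  "dunkl_dirichlet Rp k D f = (THE h. dunkl_dirichlet_solution Rp k D f h)"

definition schrodinger_dirichlet_solution ::
    "'a::euclidean_space set \<Rightarrow> ('a \<Rightarrow> real) \<Rightarrow> ('a \<Rightarrow> real) \<Rightarrow> ('a \<Rightarrow> real) \<Rightarrow> bool" where
  "schrodinger_dirichlet_solution D q g h \<longleftrightarrow>
     continuous_on (closure D) h \<and> (\<forall>x. x \<notin> closure D \<longrightarrow> h x = 0) \<and>
     (\<forall>x\<in>frontier D. h x = g x) \<and>
     (\<forall>\<phi>. test_function D \<phi> \<longrightarrow>
        (LINT x:D|lborel. h x * (laplacian \<phi> x - q x * \<phi> x)) = 0)"

definition schrodinger_dirichlet ::
    "'a::euclidean_space set \<Rightarrow> ('a \<Rightarrow> real) \<Rightarrow> ('a \<Rightarrow> real) \<Rightarrow> 'a \<Rightarrow> real" where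
  "schrodinger_dirichlet D q g = (THE h. schrodinger_dirichlet_solution D q g h)"


section \<open>Harmonic measures\<close>

text \<open>Measures on a closed set \<open>S\<close> are Borel measures on the whole space not charging the
  complement of \<open>S\<close>; in Euclidean space local finiteness implies regularity.\<close>

definition radon_measure_on :: "'a::euclidean_space set \<Rightarrow> 'a measure \<Rightarrow> bool" where
  "radon_measure_on S M \<longleftrightarrow> sets M = sets borel \<and> emeasure M (- S) = 0 \<and>
     (\<forall>K. compact K \<longrightarrow> emeasure M K < \<infinity>)"

definition represents_on ::
    "'a::euclidean_space set \<Rightarrow> 'a measure \<Rightarrow> (('a \<Rightarrow> real) \<Rightarrow> real) \<Rightarrow> bool" where
  "represents_on S M \<Lambda> \<longleftrightarrow>
     (\<forall>f. continuous_on S f \<longrightarrow> set_integrable M S f \<and> (LINT y:S|M. f y) = \<Lambda> f)"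

definition dunkl_harmonic_measure ::
    "'a::euclidean_space set \<Rightarrow> ('a \<Rightarrow> real) \<Rightarrow> 'a set \<Rightarrow> 'a \<Rightarrow> 'a measure" where
  "dunkl_harmonic_measure Rp k D x =
     (THE M. radon_measure_on (- D) M \<and> represents_on (- D) M (\<lambda>f. dunkl_dirichlet Rp k D f x))"

definition schrodinger_harmonic_measure ::
    "'a::euclidean_space set \<Rightarrow> ('a \<Rightarrow> real) \<Rightarrow> 'a \<Rightarrow> 'a measure \<Rightarrow> bool" where
  "schrodinger_harmonic_measure D q x M \<longleftrightarrow>
     radon_measure_on (frontier D) M \<and>
     represents_on (frontier D) M (\<lambda>g. schrodinger_dirichlet D q g x)"


section \<open>Green function\<close>

definition green_potential_solution ::
    "'a::euclidean_space set \<Rightarrow> ('a \<Rightarrow> real) \<Rightarrow> ('a \<Rightarrow> real) \<Rightarrow> ('a \<Rightarrow> real) \<Rightarrow> bool" where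
  "green_potential_solution D q g u \<longleftrightarrow>
     continuous_on (closure D) u \<and> (\<forall>x. x \<notin> closure D \<longrightarrow> u x = 0) \<and>
     (\<forall>x\<in>frontier D. u x = 0) \<and>
     (\<forall>\<phi>. test_function D \<phi> \<longrightarrow>
        (LINT x:D|lborel. u x * (laplacian \<phi> x - q x * \<phi> x)) = - (LINT x:D|lborel. g x * \<phi> x))"

definition green_potential ::
    "'a::euclidean_space set \<Rightarrow> ('a \<Rightarrow> real) \<Rightarrow> ('a \<Rightarrow> real) \<Rightarrow> 'a \<Rightarrow> real" where
  "green_potential D q g = (THE u. green_potential_solution D q g u)"

text \<open>\<open>G\<close> takes values in \<open>[0,\<infinity>]\<close>, since the Green function is usually infinite on the diagonal;
  by integrability \<open>enn2real (G x y)\<close> is its value for almost every \<open>y\<close>. The kernel is tied to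
  the well-defined potential operator of \<open>\<Delta> - q\<close> on bounded Borel functions on \<open>D\<close>.\<close>

definition green_function ::
    "'a::euclidean_space set \<Rightarrow> ('a \<Rightarrow> real) \<Rightarrow> ('a \<Rightarrow> 'a \<Rightarrow> ennreal) \<Rightarrow> bool" where
  "green_function D q G \<longleftrightarrow>
     (\<forall>x\<in>D. G x \<in> borel_measurable borel \<and> (\<forall>y. y \<notin> D \<longrightarrow> G x y = 0) \<and>
            (\<integral>\<^sup>+y. G x y \<partial>lborel) < \<infinity>) \<and>
     (\<forall>g. set_borel_measurable borel D g \<and> bounded (g ` D) \<longrightarrow>
        (\<exists>!u. green_potential_solution D q g u) \<and>
        (\<forall>x\<in>D. green_potential D q g x = (LINT y:D|lborel. enn2real (G x y) * g y)))"

end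

theory Submission
  imports Defs
begin

text \<open>Put \<open>s = sqrt w\<^sub>k\<close>, which is smooth and positive on the Weyl chamber containing the closure of
  \<open>D\<close>. Since the cross terms of \<open>\<bar>\<nabla> log s\<bar>\<^sup>2\<close> cancel, conjugation by \<open>s\<close> turns the differential part of the
  Dunkl Laplacian into \<open>\<Delta> - q\<close>. The reflections move \<open>D\<close> off itself, so the difference part of the
  operator only sees the prescribed values \<open>f\<close> outside \<open>D\<close> and becomes an inhomogeneous term: \<open>h\<close> solves the
  Dunkl Dirichlet problem for \<open>f\<close> if and only if \<open>u = s h\<close> weakly solves
  \<open>(\<Delta> - q) u = - s(y) \<Sum>\<^sub>\<alpha> \<bar>\<alpha>\<bar>\<^sup>2 k(\<alpha>) / \<langle>y, \<alpha>\<rangle>\<^sup>2 f(\<sigma>\<^sub>\<alpha> y)\<close> in \<open>D\<close> with boundary values \<open>s f\<close>. Thus \<open>u\<close> is a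
  Schroedinger Dirichlet solution plus a Green potential, and substituting \<open>\<sigma>\<^sub>\<alpha> y\<close> for \<open>y\<close> in the latter
  exhibits the harmonic measure. Its total mass is one because constants are harmonic.\<close>

section \<open>Lebesgue measure and Radon measures\<close>

text \<open>The harmonic measure is a definite description built on solutions that are themselves
  definite descriptions, so existence and uniqueness must precede any formula. Both are transferred
  to \<open>\<Delta> - q\<close>: uniqueness holds because the Green potential of zero is the only
  weak solution with zero data, existence comes from correcting a classical harmonic extension by a
  potential. The measure is read off from the claimed identity and then recognised, since its
  integrals of continuous functions determine it. The obstacle is that \<open>s\<close> is smooth
  and positive only near \<open>D\<close>, while the Dunkl problem lives on the whole space and
  \<open>s\<close> vanishes on the root hyperplanes. Three facts confine all computations to where
  \<open>s\<close> is harmless: test functions vanish outside a compact subset of \<open>D\<close>;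
  each root has constant sign on the connected set \<open>U\<close>, and its reflection reverses
  that sign; the constructed measure charges only the boundary and the reflected copies of
  \<open>D\<close>, where \<open>s\<close> is positive.\<close>

lemma nn_integral_lborel_translate:
  fixes f :: "'a::euclidean_space \<Rightarrow> ennreal"
  assumes "f \<in> borel_measurable borel"
  shows "(\<integral>\<^sup>+x. f (c + x) \<partial>lborel) = (\<integral>\<^sup>+x. f x \<partial>lborel)"
  using assms by (subst (2) lborel_distr_plus[of c, symmetric]) (simp add: nn_integral_distr)

lemma integral_lborel_translate:
  fixes f :: "'a::euclidean_space \<Rightarrow> real"
  assumes "f \<in> borel_measurable borel"
  shows "(LINT x|lborel. f (c + x)) = (LINT x|lborel. f x)"
  using assms by (subst (2) lborel_distr_plus[of c, symmetric]) (simp add: integral_distr)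

text \<open>Uniqueness of Haar measure: for symmetric \<open>B\<close>, Fubini gives \<open>\<mu>(A) \<lambda>(B) = \<lambda>(A) \<mu>(B)\<close>, and
  the unit ball \<open>B\<close> has the same measure under \<open>\<lambda>\<close> and its image \<open>\<mu>\<close>.\<close>

lemma lborel_distr_orthogonal:
  fixes f :: "'a::euclidean_space \<Rightarrow> 'a"
  assumes f: "orthogonal_transformation f"
  shows "distr lborel borel f = lborel"
proof -
  define \<mu> where "\<mu> = distr lborel borel f"
  have lin: "linear f" and nf: "norm (f x) = norm x" for x
    using f orthogonal_transformation_norm by (auto simp: orthogonal_transformation_def)
  have fm[measurable]: "f \<in> borel_measurable borel"
    using lin by (intro borel_measurable_continuous_onI linear_continuous_on)
      (simp add: linear_conv_bounded_linear)
  have sets[simp, measurable_cong]: "sets \<mu> = sets borel" and sp[simp]: "space \<mu> = UNIV"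
    by (auto simp: \<mu>_def)
  have trans: "(\<integral>\<^sup>+x. g (c + x) \<partial>\<mu>) = (\<integral>\<^sup>+x. g x \<partial>\<mu>)" if [measurable]: "g \<in> borel_measurable borel" for g c
  proof -
    obtain b where b: "f b = c"
      using orthogonal_transformation_surj[OF f] by (metis surjD)
    have "(\<integral>\<^sup>+x. g (c + x) \<partial>\<mu>) = (\<integral>\<^sup>+x. g (f (b + x)) \<partial>lborel)"
      by (simp add: \<mu>_def nn_integral_distr linear_add[OF lin] b)
    also have "\<dots> = (\<integral>\<^sup>+x. g (f x) \<partial>lborel)"
      by (rule nn_integral_lborel_translate) measurable
    finally show ?thesis by (simp add: \<mu>_def nn_integral_distr)
  qed
  have ball: "emeasure \<mu> (ball 0 r) = emeasure lborel (ball 0 r :: 'a set)" for r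
  proof -
    have "f -` ball 0 r = ball 0 r" by (auto simp: nf)
    then show ?thesis by (simp add: \<mu>_def emeasure_distr)
  qed
  have "sigma_finite_measure \<mu>"
  proof
    show "\<exists>A. countable A \<and> A \<subseteq> sets \<mu> \<and> \<Union>A = space \<mu> \<and> (\<forall>a\<in>A. emeasure \<mu> a \<noteq> \<infinity>)"
    proof (intro exI conjI ballI)
      show "countable (range (\<lambda>n::nat. ball (0::'a) (real n)))" by simp
      show "\<Union>(range (\<lambda>n::nat. ball (0::'a) (real n))) = space \<mu>"
        using reals_Archimedean2 by (auto)
      fix a assume "a \<in> range (\<lambda>n::nat. ball (0::'a) (real n))"
      then show "emeasure \<mu> a \<noteq> \<infinity>"
        using ball emeasure_bounded_finite[of "ball (0::'a) _"] by (auto simp: less_top)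
    qed auto
  qed
  then interpret P: pair_sigma_finite \<mu> lborel
    by (simp add: pair_sigma_finite_def sigma_finite_lborel)
  have "emeasure \<mu> A = emeasure lborel A" if [measurable]: "A \<in> sets borel" for A
  proof -
    define B where "B = ball (0::'a) 1"
    have [measurable]: "B \<in> sets borel" and B: "- x \<in> B \<longleftrightarrow> x \<in> B" for x
      by (simp_all add: B_def)
    \<comment> \<open>The inner integral is \<lambda>(B) by translation invariance of Lebesgue
      measure. Once the integrals are exchanged, invariance of \<mu> shifts \<open>x\<close> by
      \<open>y\<close>; the second indicator then depends on \<open>- x\<close> only, and symmetry
      of \<open>B\<close> removes the sign.\<close>
    have "emeasure \<mu> A * emeasure lborel B
        = (\<integral>\<^sup>+x. indicator A x * (\<integral>\<^sup>+y. indicator B (- x + y) \<partial>lborel) \<partial>\<mu>)"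
      by (subst nn_integral_lborel_translate[OF borel_measurable_indicator]) (simp_all add: nn_integral_multc)
    also have "\<dots> = (\<integral>\<^sup>+x. (\<integral>\<^sup>+y. indicator A x * indicator B (- x + y) \<partial>lborel) \<partial>\<mu>)"
      by (intro nn_integral_cong nn_integral_cmult[symmetric]) measurable
    also have "\<dots> = (\<integral>\<^sup>+y. (\<integral>\<^sup>+x. indicator A x * indicator B (- x + y) \<partial>\<mu>) \<partial>lborel)"
      by (rule P.Fubini'[symmetric]) measurable
    also have "\<dots> = (\<integral>\<^sup>+y. (\<integral>\<^sup>+x. indicator A (y + x) * indicator B (- (y + x) + y) \<partial>\<mu>) \<partial>lborel)"
      by (intro nn_integral_cong trans[symmetric]) measurable
    also have "\<dots> = (\<integral>\<^sup>+y. (\<integral>\<^sup>+x. indicator A (y + x) * indicator B x \<partial>\<mu>) \<partial>lborel)"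
      by (intro nn_integral_cong) (simp add: indicator_def B)
    also have "\<dots> = (\<integral>\<^sup>+x. (\<integral>\<^sup>+y. indicator A (y + x) * indicator B x \<partial>lborel) \<partial>\<mu>)"
      by (rule P.Fubini') measurable
    also have "\<dots> = (\<integral>\<^sup>+x. (\<integral>\<^sup>+y. indicator A (x + y) \<partial>lborel) * indicator B x \<partial>\<mu>)"
      by (simp add: nn_integral_multc add.commute)
    also have "\<dots> = emeasure lborel A * emeasure \<mu> B"
      by (subst nn_integral_lborel_translate[OF borel_measurable_indicator]) (simp_all add: nn_integral_cmult)
    finally have "emeasure \<mu> A * emeasure lborel B = emeasure lborel A * emeasure lborel B"
      by (simp add: ball B_def)
    moreover have "emeasure lborel B \<noteq> 0"
      using content_ball_pos[of 1 "0::'a"] by (auto simp: measure_def B_def)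
    moreover have "emeasure lborel B < \<infinity>"
      by (rule emeasure_bounded_finite) (simp add: B_def)
    ultimately show ?thesis
      by (auto simp add: ennreal_mult_cancel_left mult.commute[of _ "emeasure lborel B"])
  qed
  then show ?thesis
    by (intro measure_eqI) (simp_all flip: \<mu>_def)
qed

section \<open>Sums of two measures\<close>

definition plus_measure :: "'a measure \<Rightarrow> 'a measure \<Rightarrow> 'a measure" where
  "plus_measure M N = measure_of (space M) (sets M) (\<lambda>A. emeasure M A + emeasure N A)"

lemma sets_plus_measure [simp, measurable_cong]: "sets (plus_measure M N) = sets M"
  and space_plus_measure [simp]: "space (plus_measure M N) = space M"
  by (auto simp: plus_measure_def)

text \<open>\<open>measure_of\<close> assigns zero to every set unless the given function is a
  measure, so the formula becomes usable only after countable additivity has been checked. The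
  common sigma-algebra is needed because \<open>plus_measure\<close> takes its measurable sets from
  \<open>M\<close> alone.\<close>

lemma emeasure_plus_measure:
  assumes "sets N = sets M" "A \<in> sets M"
  shows "emeasure (plus_measure M N) A = emeasure M A + emeasure N A"
  unfolding plus_measure_def
proof (rule emeasure_measure_of_sigma[OF sets.sigma_algebra_axioms _ _ assms(2)])
  show "positive (sets M) (\<lambda>A. emeasure M A + emeasure N A)"
    by (simp add: positive_def)
  show "countably_additive (sets M) (\<lambda>A. emeasure M A + emeasure N A)"
    using assms(1) by (auto simp: countably_additive_def suminf_emeasure suminf_add[symmetric])
qed

text \<open>Both sides are additive, positively homogeneous and continuous along increasing
  sequences in \<open>f\<close>, which reduces the claim to indicators.\<close>

lemma nn_integral_plus_measure:
  assumes "sets N = sets M" "f \<in> borel_measurable M"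
  shows "(\<integral>\<^sup>+x. f x \<partial>plus_measure M N) = (\<integral>\<^sup>+x. f x \<partial>M) + (\<integral>\<^sup>+x. f x \<partial>N)"
  using assms(2)
proof (induct rule: borel_measurable_induct)
  case (cong f g)
  then show ?case
    using sets_eq_imp_space_eq[OF assms(1)]
    by (simp cong: nn_integral_cong_simp)
next
  case (set A)
  then show ?case by (simp add: assms emeasure_plus_measure)
next
  case (mult u c)
  then show ?case using assms(1)
    by (simp add: nn_integral_cmult measurable_cong_sets[OF assms(1) refl] measurable_cong_sets[OF sets_plus_measure refl] distrib_left)
next
  case (add u v)
  then show ?case using assms(1)
    by (simp add: nn_integral_add measurable_cong_sets[OF assms(1) refl] measurable_cong_sets[OF sets_plus_measure refl] ac_simps)
next
  case (seq U)
  have U: "U i \<in> borel_measurable (plus_measure M N)" "U i \<in> borel_measurable N" for i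
    using seq(1) assms(1) by (auto simp: measurable_cong_sets[OF assms(1) refl] measurable_cong_sets[OF sets_plus_measure refl])
  \<comment> \<open>Monotonicity of both sequences is what allows the supremum of the sums to be
    split into the sum of the suprema.\<close>
  have inc: "incseq (\<lambda>i. \<integral>\<^sup>+x. U i x \<partial>M)" "incseq (\<lambda>i. \<integral>\<^sup>+x. U i x \<partial>N)"
    using seq(4) by (auto intro!: incseq_nn_integral)
  show ?case
    using seq U inc by (simp add: nn_integral_monotone_convergence_SUP image_comp ennreal_SUP_add SUP_apply)
qed

text \<open>The integrals of the positive and the negative part are finite under both measures, so
  \<open>enn2real\<close> distributes over their sums.\<close>

lemma
  fixes f :: "'a \<Rightarrow> real"
  assumes "sets N = sets M" "integrable M f" "integrable N f"
  shows integrable_plus_measure: "integrable (plus_measure M N) f"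
    and integral_plus_measure: "integral\<^sup>L (plus_measure M N) f = integral\<^sup>L M f + integral\<^sup>L N f"
proof -
  have m: "f \<in> borel_measurable M" using assms(2) by auto
  note [simp] = nn_integral_plus_measure[OF assms(1)]
  have m': "f \<in> borel_measurable (plus_measure M N)"
    using m by (simp add: measurable_cong_sets[OF sets_plus_measure refl])
  show i: "integrable (plus_measure M N) f"
    using assms(2,3) m m' by (auto simp: integrable_iff_bounded)
  have "(\<integral>\<^sup>+x. ennreal (f x) \<partial>M) < \<infinity>" "(\<integral>\<^sup>+x. ennreal (f x) \<partial>N) < \<infinity>"
    "(\<integral>\<^sup>+x. ennreal (- f x) \<partial>M) < \<infinity>" "(\<integral>\<^sup>+x. ennreal (- f x) \<partial>N) < \<infinity>"
    using assms(2,3) by (auto simp: real_integrable_def less_top)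
  then show "integral\<^sup>L (plus_measure M N) f = integral\<^sup>L M f + integral\<^sup>L N f"
    using m i assms(2,3) by (simp add: real_lebesgue_integral_def enn2real_plus)
qed

text \<open>The continuous functions \<open>max 0 (1 - n * infdist x C)\<close> decrease to the
  indicator of a closed set \<open>C\<close>, so \<Lambda> determines the mass of \<open>C\<close>.
  Representing the constant 1 forces finite total mass, which justifies dominated convergence.
  Closed sets form an intersection-stable generator of the Borel sets, hence the measures
  agree.\<close>

lemma represents_on_unique:
  fixes M N :: "'a::euclidean_space measure"
  assumes S: "closed S"
    and M: "radon_measure_on S M" "represents_on S M \<Lambda>"
    and N: "radon_measure_on S N" "represents_on S N \<Lambda>"
  shows "M = N"
proof -
  have meas: "emeasure L C = ennreal (lim (\<lambda>n. \<Lambda> (\<lambda>x. max 0 (1 - real n * infdist x C))))"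
    and fin: "emeasure L UNIV < \<infinity>"
    if L: "radon_measure_on S L" "represents_on S L \<Lambda>" and C: "closed C" "C \<noteq> {}" for L :: "'a measure" and C
  proof -
    have s[simp, measurable_cong]: "sets L = sets borel" and n: "emeasure L (- S) = 0"
      using L by (auto simp: radon_measure_on_def)
    have sp[simp]: "space L = UNIV" using sets_eq_imp_space_eq[OF s] by simp
    have [measurable]: "S \<in> sets borel" using S by simp
    have AE: "AE x in L. x \<in> S"
      using n by (intro AE_I[of _ _ "- S"]) auto
    have r: "set_integrable L S f \<and> (LINT y:S|L. f y) = \<Lambda> f" if "continuous_on S f" for f
      using L that by (auto simp: represents_on_def)
    have "set_integrable L S (\<lambda>_. 1 :: real)" using r[of "\<lambda>_. 1"] by simp
    then have "emeasure L S < \<infinity>"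
      by (simp add: set_integrable_def integrable_indicator_iff)
    moreover have "emeasure L UNIV = emeasure L S"
      using AE by (intro emeasure_eq_AE) auto
    ultimately show fin: "emeasure L UNIV < \<infinity>" by simp
    then interpret finite_measure L by (intro finite_measureI) auto
    define g where "g n x = max 0 (1 - real n * infdist x C)" for n x
    have cg: "continuous_on A (g n)" for n A
      unfolding g_def by (intro continuous_intros)
    have [measurable]: "g n \<in> borel_measurable borel" for n
      using cg[of UNIV n] by (rule borel_measurable_continuous_onI)
    have \<Lambda>g: "\<Lambda> (g n) = (LINT x|L. g n x)" for n
    proof -
      have "\<Lambda> (g n) = (LINT x:S|L. g n x)" using r[OF cg] by simp
      also have "\<dots> = (LINT x|L. g n x)"
        unfolding set_lebesgue_integral_def using AE by (intro integral_cong_AE) auto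
      finally show ?thesis .
    qed
    have "(\<lambda>n. LINT x|L. g n x) \<longlonglongrightarrow> (LINT x|L. indicator C x)"
    proof (rule integral_dominated_convergence[where w="\<lambda>_. 1"])
      show "AE x in L. (\<lambda>n. g n x) \<longlonglongrightarrow> indicator C x"
      proof (rule AE_I2)
        fix x
        show "(\<lambda>n. g n x) \<longlonglongrightarrow> indicator C x"
        proof (cases "x \<in> C")
          case True
          then show ?thesis by (simp add: g_def)
        next
          case False
          then have p: "infdist x C > 0"
            using C infdist_pos_not_in_closed by blast
          then obtain N where N: "1 < real N * infdist x C"
            using reals_Archimedean3 by blast
          have "g n x = 0" if "n \<ge> N" for n
          proof -
            have "real N * infdist x C \<le> real n * infdist x C"
              using that p by (intro mult_right_mono) auto
            then show ?thesis using N by (auto simp: g_def)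
          qed
          then show ?thesis
            using False by (intro tendsto_eventually) (auto simp: eventually_sequentially)
        qed
      qed
      show "AE x in L. norm (g n x) \<le> 1" for n
        by (auto simp: g_def infdist_nonneg)
    qed (use C in \<open>auto intro!: borel_measurable_indicator\<close>)
    then have "lim (\<lambda>n. \<Lambda> (g n)) = measure L C"
      using C by (simp add: \<Lambda>g limI)
    then show "emeasure L C = ennreal (lim (\<lambda>n. \<Lambda> (\<lambda>x. max 0 (1 - real n * infdist x C))))"
      by (simp add: emeasure_eq_measure g_def[abs_def])
  qed
  show ?thesis
  proof (rule measure_eqI_generator_eq[where E="{C. closed C}" and \<Omega>=UNIV and A="\<lambda>_. UNIV"])
    show "Int_stable {C::'a set. closed C}" by (auto simp: Int_stable_def)
    show "emeasure M X = emeasure N X" if "X \<in> {C. closed C}" for X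
    \<comment> \<open>By convention \<open>infdist x {}\<close> is 0, which would make all
      approximating functions constantly 1; the empty set is therefore treated apart.\<close>
    proof (cases "X = {}")
      case False
      then show ?thesis using meas[OF M] meas[OF N] that by simp
    qed simp
    show "sets M = sigma_sets UNIV {C. closed C}" "sets N = sigma_sets UNIV {C. closed C}"
      using M N by (auto simp: radon_measure_on_def borel_eq_closed)
    show "emeasure M UNIV \<noteq> \<infinity>" using fin[OF M, of UNIV] by auto
  qed auto
qed

section \<open>Functions of class \<open>C\<^sup>k\<close>\<close>

text \<open>\<open>frechet_derivative\<close> is a choice among derivatives. Near \<open>x\<close>
  the functions have the same derivatives, so the choices coincide, even where no derivative
  exists.\<close>

lemma frechet_derivative_cong_open:
  assumes "open S" "x \<in> S" "\<And>y. y \<in> S \<Longrightarrow> f y = g y"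
  shows "frechet_derivative f (at x) = frechet_derivative g (at x)"
    and "f differentiable at x \<longleftrightarrow> g differentiable at x"
proof -
  have iff: "(f has_derivative F) (at x) \<longleftrightarrow> (g has_derivative F) (at x)" for F
    using assms has_derivative_transform_within_open[of f F x UNIV S g]
      has_derivative_transform_within_open[of g F x UNIV S f] by auto
  show "frechet_derivative f (at x) = frechet_derivative g (at x)"
    by (simp add: frechet_derivative_def iff)
  show "f differentiable at x \<longleftrightarrow> g differentiable at x"
    by (simp add: differentiable_def iff)
qed

lemma C_k_on_cong:
  assumes "open S" "\<And>y. y \<in> S \<Longrightarrow> f y = g y"
  shows "C_k_on n S f \<longleftrightarrow> C_k_on n S g"
  using assms(2)
proof (induction n arbitrary: f g)
  case 0
  then show ?case using continuous_on_cong by auto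
next
  case (Suc n)
  have "C_k_on n S (\<lambda>x. frechet_derivative f (at x) b) \<longleftrightarrow> C_k_on n S (\<lambda>x. frechet_derivative g (at x) b)" for b
    by (rule Suc.IH) (use frechet_derivative_cong_open(1)[OF assms(1) _ Suc.prems] in simp)
  then show ?case
    using frechet_derivative_cong_open(2)[OF assms(1) _ Suc.prems] by simp
qed

lemma C_k_on_subset: "C_k_on n S f \<Longrightarrow> T \<subseteq> S \<Longrightarrow> C_k_on n T f"
  by (induction n arbitrary: f) (auto intro: continuous_on_subset)

lemma C_k_on_mono: "C_k_on n S f \<Longrightarrow> m \<le> n \<Longrightarrow> C_k_on m S f"
proof (induction n arbitrary: m f)
  case (Suc n)
  show ?case
  proof (cases m)
    case 0
    then show ?thesis using Suc.prems
      by (auto intro!: continuous_at_imp_continuous_on differentiable_imp_continuous_within)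
  next
    case (Suc m')
    then show ?thesis using Suc.prems Suc.IH by auto
  qed
qed simp

lemma C_k_on_imp_continuous_on: "C_k_on n S f \<Longrightarrow> continuous_on S f"
  using C_k_on_mono[of n S f 0] by simp

lemma C_k_on_Suc_partial:
  "C_k_on (Suc n) S f \<Longrightarrow> b \<in> Basis \<Longrightarrow> C_k_on n S (\<lambda>x. frechet_derivative f (at x) b)"
  by simp

text \<open>Lets an explicit derivative \<open>F\<close> stand in for the chosen
  \<open>frechet_derivative\<close>, so that inductions can run on closed formulas.\<close>

lemma C_k_on_SucI:
  assumes "open S" "\<And>x. x \<in> S \<Longrightarrow> (f has_derivative F x) (at x)"
    "\<And>b. b \<in> Basis \<Longrightarrow> C_k_on n S (\<lambda>x. F x b)"
  shows "C_k_on (Suc n) S f"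
proof -
  have F: "frechet_derivative f (at x) = F x" if "x \<in> S" for x
    using assms(2)[OF that] by (metis frechet_derivative_at)
  have "C_k_on n S (\<lambda>x. frechet_derivative f (at x) b)" if "b \<in> Basis" for b
    using assms(3)[OF that] C_k_on_cong[OF assms(1), of "\<lambda>x. F x b" "\<lambda>x. frechet_derivative f (at x) b"] F by simp
  then show ?thesis using assms(2) by (auto simp: differentiable_def)
qed

lemma C_k_on_Suc_has_derivative:
  "C_k_on (Suc n) S f \<Longrightarrow> x \<in> S \<Longrightarrow> (f has_derivative frechet_derivative f (at x)) (at x)"
  by (simp add: frechet_derivative_works)

lemma C_k_on_const: "C_k_on n S (\<lambda>x. c)"
  by (induction n arbitrary: c) auto

lemma C_k_on_add:
  assumes "open S" "C_k_on n S f" "C_k_on n S g"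
  shows "C_k_on n S (\<lambda>x. f x + g x)"
  using assms(2,3)
proof (induction n arbitrary: f g)
  case 0 then show ?case by (auto intro: continuous_on_add)
next
  case (Suc n)
  show ?case
    by (rule C_k_on_SucI[OF assms(1) has_derivative_add[OF C_k_on_Suc_has_derivative[OF Suc.prems(1)] C_k_on_Suc_has_derivative[OF Suc.prems(2)]]])
      (use Suc in auto)
qed

lemma C_k_on_mult:
  assumes "open S" "C_k_on n S f" "C_k_on n S g"
  shows "C_k_on n S (\<lambda>x. f x * g x)"
  using assms(2,3)
proof (induction n arbitrary: f g)
  case 0 then show ?case by (auto intro: continuous_on_mult)
next
  case (Suc n)
  have "C_k_on n S f" "C_k_on n S g" using Suc.prems C_k_on_mono[of "Suc n" S _ n] by auto
  then show ?case
    by (intro C_k_on_SucI[OF assms(1) has_derivative_mult[OF C_k_on_Suc_has_derivative[OF Suc.prems(1)] C_k_on_Suc_has_derivative[OF Suc.prems(2)]]]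
        C_k_on_add[OF assms(1)] Suc.IH) (use Suc.prems in auto)
qed

lemma C_k_on_prod:
  assumes "open S" "\<And>i. i \<in> I \<Longrightarrow> C_k_on n S (f i)"
  shows "C_k_on n S (\<lambda>x. \<Prod>i\<in>I. f i x)"
  using assms(2) by (induction I rule: infinite_finite_induct) (auto intro: C_k_on_const C_k_on_mult[OF assms(1)])

text \<open>Differentiation lowers the exponent by one, so the induction must keep \<open>a\<close>
  arbitrary. Positivity of the linear form makes the power rule valid for every real
  exponent.\<close>

lemma C_k_on_inner_powr:
  assumes "open S" "\<And>x. x \<in> S \<Longrightarrow> 0 < x \<bullet> v"
  shows "C_k_on n S (\<lambda>x. (x \<bullet> v) powr a)"
proof (induction n arbitrary: a)
  case 0
  show ?case using assms(2) by (auto intro!: continuous_intros simp: less_imp_neq[symmetric])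
next
  case (Suc n)
  have "((\<lambda>x. (x \<bullet> v) powr a) has_derivative (\<lambda>h. (a * (h \<bullet> v)) * (x \<bullet> v) powr (a - 1))) (at x)" if "x \<in> S" for x
    using assms(2)[OF that]
    by (auto intro!: derivative_eq_intros simp: powr_diff fun_eq_iff)
  then show ?case
    by (rule C_k_on_SucI[OF assms(1)]) (auto intro!: C_k_on_mult[OF assms(1)] C_k_on_const Suc.IH)
qed

lemma C_k_on_2_laplacian_continuous:
  assumes "C_k_on 2 S f"
  shows "continuous_on S (laplacian f)"
proof -
  have "continuous_on S (\<lambda>x. frechet_derivative (\<lambda>y. frechet_derivative f (at y) b) (at x) b)" if "b \<in> Basis" for b
    using assms that by (simp add: numeral_2_eq_2)
  then show ?thesis unfolding laplacian_def[abs_def] by (intro continuous_on_sum)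
qed

lemma laplacian_mult:
  assumes S: "open S" "x \<in> S" and f: "C_k_on 2 S f" and g: "C_k_on 2 S g"
  shows "laplacian (\<lambda>y. f y * g y) x = f x * laplacian g x
    + 2 * (\<Sum>b\<in>Basis. frechet_derivative f (at x) b * frechet_derivative g (at x) b) + g x * laplacian f x"
proof -
  have f': "C_k_on (Suc (Suc 0)) S f" and g': "C_k_on (Suc (Suc 0)) S g"
    using f g by (simp_all add: numeral_2_eq_2)
  note fd = C_k_on_Suc_has_derivative[OF f'] C_k_on_Suc_has_derivative[OF g']
  have 1: "frechet_derivative (\<lambda>y. f y * g y) (at y) b
      = f y * frechet_derivative g (at y) b + frechet_derivative f (at y) b * g y" if "y \<in> S" for y b
    using fun_cong[OF frechet_derivative_at[OF has_derivative_mult[OF fd(1)[OF that] fd(2)[OF that]]], of b] by simp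
  have "frechet_derivative (\<lambda>y. frechet_derivative (\<lambda>y. f y * g y) (at y) b) (at x) b
    = f x * frechet_derivative (\<lambda>y. frechet_derivative g (at y) b) (at x) b
    + 2 * (frechet_derivative f (at x) b * frechet_derivative g (at x) b)
    + g x * frechet_derivative (\<lambda>y. frechet_derivative f (at y) b) (at x) b" if "b \<in> Basis" for b
  proof -
    note sd = C_k_on_Suc_has_derivative[OF C_k_on_Suc_partial[OF f' that] S(2)]
        C_k_on_Suc_has_derivative[OF C_k_on_Suc_partial[OF g' that] S(2)]
    have hd: "((\<lambda>y. f y * frechet_derivative g (at y) b + frechet_derivative f (at y) b * g y) has_derivative
      (\<lambda>h. (f x * frechet_derivative (\<lambda>y. frechet_derivative g (at y) b) (at x) h + frechet_derivative f (at x) h * frechet_derivative g (at x) b)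
         + (frechet_derivative f (at x) b * frechet_derivative g (at x) h + frechet_derivative (\<lambda>y. frechet_derivative f (at y) b) (at x) h * g x))) (at x)"
      by (intro has_derivative_add has_derivative_mult sd fd S(2))
    have "frechet_derivative (\<lambda>y. frechet_derivative (\<lambda>y. f y * g y) (at y) b) (at x)
      = frechet_derivative (\<lambda>y. f y * frechet_derivative g (at y) b + frechet_derivative f (at y) b * g y) (at x)"
      by (rule frechet_derivative_cong_open(1)[OF S]) (rule 1)
    then show ?thesis
      using fun_cong[OF frechet_derivative_at[OF hd], of b] by (simp add: algebra_simps)
  qed
  then show ?thesis
    by (simp add: laplacian_def sum.distrib sum_distrib_left)
qed

lemma test_functionD:
  assumes "test_function D \<phi>"
  shows "C_k_on n UNIV \<phi>" "compact (closure {x. \<phi> x \<noteq> 0})" "closure {x. \<phi> x \<noteq> 0} \<subseteq> D"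
  using assms by (auto simp: test_function_def)

text \<open>The complement of the support is open and the function is zero on all of it, so
  derivatives of every order vanish there as well.\<close>

lemma test_function_eq_0:
  assumes "x \<notin> closure {x. \<phi> x \<noteq> 0}"
  shows "\<phi> x = 0" "frechet_derivative \<phi> (at x) = (\<lambda>h. 0)" "laplacian \<phi> x = 0"
    "frechet_derivative (\<lambda>y. frechet_derivative \<phi> (at y) b) (at x) = (\<lambda>h. 0)"
proof -
  define S where "S = - closure {x. \<phi> x \<noteq> 0}"
  have S: "open S" and x: "x \<in> S" using assms by (auto simp: S_def)
  have 0: "\<phi> y = 0" if "y \<in> S" for y using that closure_subset[of "{x. \<phi> x \<noteq> 0}"] by (auto simp: S_def)
  have 1: "frechet_derivative \<phi> (at y) = (\<lambda>h. 0)" if "y \<in> S" for y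
    using frechet_derivative_cong_open(1)[OF S that 0] by simp
  have 2: "frechet_derivative (\<lambda>y. frechet_derivative \<phi> (at y) b) (at y) = (\<lambda>h. 0)" if "y \<in> S" for y b
    using frechet_derivative_cong_open(1)[OF S that, of "\<lambda>y. frechet_derivative \<phi> (at y) b" "\<lambda>y. 0"] 1 by simp
  show "\<phi> x = 0" "frechet_derivative \<phi> (at x) = (\<lambda>h. 0)" "laplacian \<phi> x = 0"
    "frechet_derivative (\<lambda>y. frechet_derivative \<phi> (at y) b) (at x) = (\<lambda>h. 0)"
    using x 0 1 2 by (auto simp: laplacian_def)
qed

text \<open>The factor \<open>f\<close> is controlled on \<open>U\<close> only, and this suffices:
  \<open>U\<close> and the complement of the support of \<phi> are open and cover the space, and on
  the latter the product is zero. This is needed because \<open>s\<close> and its inverse are smooth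
  only within the chamber.\<close>

lemma test_function_mult_smooth:
  assumes \<phi>: "test_function D \<phi>" and U: "open U" "D \<subseteq> U" and f: "\<And>n. C_k_on n U f"
  shows "test_function D (\<lambda>x. f x * \<phi> x)"
proof -
  define K where "K = closure {x. \<phi> x \<noteq> 0}"
  have K: "compact K" "K \<subseteq> D" and 0: "x \<notin> K \<Longrightarrow> \<phi> x = 0" for x
    using test_functionD(2,3)[OF \<phi>] test_function_eq_0(1)[of x \<phi>] by (simp_all add: K_def)
  have sub: "closure {x. f x * \<phi> x \<noteq> 0} \<subseteq> K" unfolding K_def by (intro closure_mono) auto
  have C: "C_k_on n U (\<lambda>x. f x * \<phi> x)" for n
    using f C_k_on_subset[OF test_functionD(1)[OF \<phi>]] by (intro C_k_on_mult[OF U(1)]) auto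
  have C0: "C_k_on n (- K) (\<lambda>x. f x * \<phi> x)" for n
    using C_k_on_cong[of "- K" "\<lambda>x. f x * \<phi> x" "\<lambda>x. 0" n] 0 K by (auto simp: compact_imp_closed open_Compl C_k_on_const)
  have un: "U \<union> - K = UNIV" using K(2) U by auto
  have glue: "C_k_on n (U \<union> - K) g" if "C_k_on n U g" "C_k_on n (- K) g" for n and g :: "'a \<Rightarrow> real"
    using that
  proof (induction n arbitrary: g)
    case 0
    then show ?case using U K by (auto intro!: continuous_on_open_Un simp: compact_imp_closed open_Compl)
  qed auto
  have "C_k_on n UNIV (\<lambda>x. f x * \<phi> x)" for n
    using glue[OF C C0, of n] unfolding un .
  moreover have "compact (closure {x. f x * \<phi> x \<noteq> 0})"
    using K(1) sub by (auto simp: compact_eq_bounded_closed intro: bounded_subset)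
  ultimately show ?thesis
    using sub K(2) by (auto simp: test_function_def)
qed

lemma frechet_derivative_eq_sum_Basis:
  assumes "f differentiable (at x)"
  shows "frechet_derivative f (at x) v = (\<Sum>b\<in>Basis. (b \<bullet> v) * frechet_derivative f (at x) b)"
proof -
  interpret linear "frechet_derivative f (at x)"
    using assms by (rule linear_frechet_derivative)
  have "frechet_derivative f (at x) v = frechet_derivative f (at x) (\<Sum>b\<in>Basis. (v \<bullet> b) *\<^sub>R b)"
    by (simp add: euclidean_representation)
  then show ?thesis by (simp add: sum scale inner_commute)
qed

section \<open>Integration by parts\<close>

lemma integrable_continuous_compact_support:
  fixes f :: "'a::euclidean_space \<Rightarrow> real"
  assumes "compact K" "continuous_on K f" "\<And>x. x \<notin> K \<Longrightarrow> f x = 0"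
  shows "integrable lborel f"
proof -
  have "(\<lambda>x. indicator K x *\<^sub>R f x) = f" using assms(3) by (intro ext) (auto simp: indicator_def)
  then show ?thesis using borel_integrable_compact[OF assms(1,2)] by simp
qed

lemma integrable_lborel_translate:
  fixes f :: "'a::euclidean_space \<Rightarrow> real"
  assumes "integrable lborel f"
  shows "integrable lborel (\<lambda>x. f (c + x))"
proof -
  have "f \<in> borel_measurable borel" using assms by auto
  then show ?thesis
    using assms integrable_distr_eq[of "(+) c" lborel borel f] by (simp add: lborel_distr_plus)
qed

text \<open>By translation invariance all difference quotients have integral zero.\<close>

lemma integral_directional_derivative_eq_0:
  fixes F :: "'a::euclidean_space \<Rightarrow> real"
  assumes F: "\<And>x. (F has_derivative F' x) (at x)"
    and K: "compact K" "\<And>x. x \<notin> K \<Longrightarrow> F x = 0"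
    and B: "\<And>x. \<bar>F' x b\<bar> \<le> B"
  shows "(LINT x|lborel. F' x b) = 0"
proof -
  have contF: "continuous_on A F" for A
    using F by (meson continuous_at_imp_continuous_on has_derivative_continuous)
  have intF: "integrable lborel F"
    using integrable_continuous_compact_support[OF K(1) contF K(2)] .
  have [measurable]: "F \<in> borel_measurable borel"
    using contF by (rule borel_measurable_continuous_onI)
  have D: "((\<lambda>t. F (x + t *\<^sub>R b)) has_real_derivative F' (x + t *\<^sub>R b) b) (at t)" for x t
  proof -
    interpret L: bounded_linear "F' (x + t *\<^sub>R b)" using F has_derivative_bounded_linear by blast
    have "((\<lambda>t. F (x + t *\<^sub>R b)) has_derivative (\<lambda>h. F' (x + t *\<^sub>R b) (h *\<^sub>R b))) (at t)"
      by (rule has_derivative_compose[OF _ F]) (auto intro!: derivative_eq_intros)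
    then show ?thesis
      by (simp add: has_field_derivative_def L.scaleR mult.commute[of "F' _ b"] mult_commute_abs)
  qed
  define f where "f n x = real (Suc n) * (F (inverse (real (Suc n)) *\<^sub>R b + x) - F x)" for n x
  obtain r where r: "\<And>x. x \<in> K \<Longrightarrow> norm x \<le> r"
    using compact_imp_bounded[OF K(1)] by (auto simp: bounded_iff)
  have lim: "(\<lambda>n. f n x) \<longlonglongrightarrow> F' x b" for x
  proof -
    have "((\<lambda>h. (F (x + h *\<^sub>R b) - F x) / h) \<longlongrightarrow> F' x b) (at 0)"
      using D[of x 0] by (simp add: DERIV_def)
    moreover have "filterlim (\<lambda>n. inverse (real (Suc n))) (at 0) sequentially"
      using LIMSEQ_inverse_real_of_nat by (simp add: filterlim_at)
    ultimately have "(\<lambda>n. (F (x + inverse (real (Suc n)) *\<^sub>R b) - F x) / inverse (real (Suc n))) \<longlonglongrightarrow> F' x b"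
      by (rule filterlim_compose)
    then show ?thesis
      by (simp add: f_def[abs_def] field_simps)
  qed
  \<comment> \<open>The mean value theorem bounds the difference quotient by \<open>B\<close>. It is
    zero unless \<open>x\<close> or the shifted point lies in \<open>K\<close>, and the step is at
    most one, whence the radius \<open>r + norm b\<close>.\<close>
  have bnd: "\<bar>f n x\<bar> \<le> B * indicator (cball 0 (r + norm b)) x" for n x
  proof (cases "x \<in> K \<or> inverse (real (Suc n)) *\<^sub>R b + x \<in> K")
    case True
    have "norm x \<le> r + norm b"
    proof (cases "x \<in> K")
      case True
      then show ?thesis using r[of x] by (smt (verit) norm_ge_zero)
    next
      case False
      then have "norm (inverse (real (Suc n)) *\<^sub>R b + x) \<le> r" using True r by auto
      moreover have "norm (inverse (real (Suc n)) *\<^sub>R b) \<le> norm b"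
        by (simp add: mult_left_le_one_le inverse_le_1_iff)
      ultimately show ?thesis
        using norm_triangle_ineq4[of "inverse (real (Suc n)) *\<^sub>R b + x" "inverse (real (Suc n)) *\<^sub>R b"] by simp
    qed
    moreover have "\<bar>f n x\<bar> \<le> B"
    proof -
      have "0 < inverse (real (Suc n))" by simp
      from MVT2[OF this D] obtain z where
        "F (x + inverse (real (Suc n)) *\<^sub>R b) - F x = inverse (real (Suc n)) * F' (x + z *\<^sub>R b) b" by auto
      then have "f n x = F' (x + z *\<^sub>R b) b" by (simp add: f_def add.commute)
      then show ?thesis using B by simp
    qed
    ultimately show ?thesis by simp
  next
    case False
    have "0 \<le> B" using B[of 0] by linarith
    then show ?thesis using False K(2) by (simp add: f_def)
  qed
  have "(\<lambda>n. LINT x|lborel. f n x) \<longlonglongrightarrow> (LINT x|lborel. F' x b)"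
  proof (rule integral_dominated_convergence[where w="\<lambda>x. B * indicator (cball 0 (r + norm b)) x"])
    show "(\<lambda>x. F' x b) \<in> borel_measurable lborel"
      by (rule borel_measurable_LIMSEQ_real[OF lim]) (simp add: f_def[abs_def])
    show "integrable lborel (\<lambda>x. B * indicator (cball (0::'a) (r + norm b)) x)"
      using emeasure_bounded_finite[of "cball (0::'a) (r + norm b)"]
      by (intro integrable_mult_right) (simp add: integrable_indicator_iff)
    show "AE x in lborel. (\<lambda>n. f n x) \<longlonglongrightarrow> F' x b" using lim by simp
    show "AE x in lborel. norm (f n x) \<le> B * indicator (cball 0 (r + norm b)) x" for n
      using bnd by simp
  qed (simp_all add: f_def[abs_def])
  moreover have "(LINT x|lborel. f n x) = 0" for n
    using intF by (simp add: f_def integrable_lborel_translate integral_lborel_translate)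
  ultimately show ?thesis
    using LIMSEQ_unique[OF _ tendsto_const] by fastforce
qed

text \<open>For each basis vector \<open>b\<close>, the difference of the two
  \<open>b\<close>-summands is the derivative in direction \<open>b\<close> of
  \<open>h * D_b \<phi> - D_b h * \<phi>\<close>, where \<open>D_b\<close> is the partial
  derivative. That function has compact support in \<open>D\<close>, so its derivative integrates to
  zero.\<close>

lemma integral_laplacian_by_parts:
  assumes h: "C_k_on 2 D h" and D: "open D" and \<phi>: "test_function D \<phi>"
  shows "(LINT x|lborel. h x * laplacian \<phi> x) = (LINT x|lborel. laplacian h x * \<phi> x)"
proof -
  define K where "K = closure {x. \<phi> x \<noteq> 0}"
  have K: "compact K" "K \<subseteq> D" using test_functionD[OF \<phi>] by (auto simp: K_def)
  have out: "\<phi> x = 0" "frechet_derivative \<phi> (at x) = (\<lambda>h. 0)" "laplacian \<phi> x = 0"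
    "frechet_derivative (\<lambda>y. frechet_derivative \<phi> (at y) b) (at x) = (\<lambda>h. 0)"
    if "x \<notin> K" for x b using test_function_eq_0 that unfolding K_def by blast+
  have \<phi>': "C_k_on (Suc (Suc 0)) UNIV \<phi>" and h': "C_k_on (Suc (Suc 0)) D h"
    using test_functionD(1)[OF \<phi>] h by (auto simp: numeral_2_eq_2)
  have cont: "continuous_on K h" "continuous_on K \<phi>" "continuous_on K (laplacian \<phi>)" "continuous_on K (laplacian h)"
    using C_k_on_imp_continuous_on[OF h] C_k_on_imp_continuous_on[OF \<phi>']
      C_k_on_2_laplacian_continuous[OF h] C_k_on_2_laplacian_continuous[OF test_functionD(1)[OF \<phi>]] K(2)
    by (auto intro: continuous_on_subset)
  have i1: "integrable lborel (\<lambda>x. h x * laplacian \<phi> x)"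
    using K(1) cont out by (intro integrable_continuous_compact_support[of K] continuous_intros) auto
  have i2: "integrable lborel (\<lambda>x. laplacian h x * \<phi> x)"
    using K(1) cont out by (intro integrable_continuous_compact_support[of K] continuous_intros) auto
  define g where "g b x = h x * frechet_derivative (\<lambda>y. frechet_derivative \<phi> (at y) b) (at x) b
    - frechet_derivative (\<lambda>y. frechet_derivative h (at y) b) (at x) b * \<phi> x" for b x
  have "integrable lborel (g b) \<and> (LINT x|lborel. g b x) = 0" if b: "b \<in> Basis" for b
  proof -
    define F where "F x = h x * frechet_derivative \<phi> (at x) b - frechet_derivative h (at x) b * \<phi> x" for x
    \<comment> \<open>Outside \<open>K\<close> the derivative is set to zero explicitly, since
      \<open>h\<close> need not be differentiable outside \<open>D\<close>.\<close>
    define F' where "F' x = (if x \<in> K then \<lambda>v.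
       (h x * frechet_derivative (\<lambda>y. frechet_derivative \<phi> (at y) b) (at x) v + frechet_derivative h (at x) v * frechet_derivative \<phi> (at x) b)
      - (frechet_derivative h (at x) b * frechet_derivative \<phi> (at x) v + frechet_derivative (\<lambda>y. frechet_derivative h (at y) b) (at x) v * \<phi> x)
      else (\<lambda>v. 0))" for x
    have F'b: "F' x b = g b x" for x
      using out[of x] by (simp add: F'_def g_def)
    have F0: "F x = 0" if "x \<notin> K" for x using out[OF that] by (simp add: F_def)
    have F: "(F has_derivative F' x) (at x)" for x
    proof (cases "x \<in> K")
      case True
      then have x: "x \<in> D" using K by auto
      show ?thesis
        unfolding F_def[abs_def] F'_def using True
        by (simp, intro has_derivative_diff has_derivative_mult)
          (use x C_k_on_Suc_has_derivative[OF \<phi>'] C_k_on_Suc_has_derivative[OF h']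
            C_k_on_Suc_has_derivative[OF C_k_on_Suc_partial[OF \<phi>' b]] C_k_on_Suc_has_derivative[OF C_k_on_Suc_partial[OF h' b]] in auto)
    next
      case False
      have "((\<lambda>x. 0) has_derivative (\<lambda>v. 0)) (at x)" by simp
      then show ?thesis
        using has_derivative_transform_within_open[of "\<lambda>x. 0" "\<lambda>v. 0" x UNIV "- K" F] False F0 K
        by (simp add: F'_def compact_imp_closed open_Compl)
    qed
    have "continuous_on UNIV (\<lambda>x. frechet_derivative (\<lambda>y. frechet_derivative \<phi> (at y) b) (at x) b)"
      "continuous_on D (\<lambda>x. frechet_derivative (\<lambda>y. frechet_derivative h (at y) b) (at x) b)"
      using b \<phi>' h' by auto
    then have cg: "continuous_on K (g b)"
      unfolding g_def[abs_def] using cont K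
      by (intro continuous_intros) (auto intro: continuous_on_subset)
    have g0: "g b x = 0" if "x \<notin> K" for x using out[OF that] by (simp add: g_def)
    have "bounded (g b ` K)" using cg K compact_continuous_image compact_imp_bounded by blast
    then obtain B where B: "\<And>x. x \<in> K \<Longrightarrow> \<bar>g b x\<bar> \<le> B" by (auto simp: bounded_iff)
    have "\<bar>F' x b\<bar> \<le> max B 0" for x using B[of x] g0[of x] by (cases "x \<in> K") (auto simp: F'b)
    from integral_directional_derivative_eq_0[OF F K(1) F0 this]
    show ?thesis using integrable_continuous_compact_support[OF K(1) cg g0] by (simp add: F'b)
  qed
  then have "(LINT x|lborel. (\<Sum>b\<in>Basis. g b x)) = 0"
    by (subst Bochner_Integration.integral_sum) auto
  moreover have "(\<Sum>b\<in>Basis. g b x) = h x * laplacian \<phi> x - laplacian h x * \<phi> x" for x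
    by (simp add: g_def sum_subtractf laplacian_def sum_distrib_left sum_distrib_right)
  ultimately show ?thesis
    using i1 i2 by simp
qed

section \<open>Reflections and positive roots\<close>

lemma inner_reflection_left: "reflection \<alpha> x \<bullet> y = x \<bullet> y - 2 * ((x \<bullet> \<alpha>) / (norm \<alpha>)\<^sup>2) * (\<alpha> \<bullet> y)"
  by (simp add: reflection_def inner_diff_left)

lemma inner_reflection_swap: "reflection \<alpha> x \<bullet> y = x \<bullet> reflection \<alpha> y"
  by (simp add: reflection_def inner_diff_left inner_diff_right inner_commute)

lemma inner_reflection_root: "\<alpha> \<noteq> 0 \<Longrightarrow> reflection \<alpha> x \<bullet> \<alpha> = - (x \<bullet> \<alpha>)"
  by (simp add: inner_reflection_left power2_norm_eq_inner)

lemma reflection_reflection: "\<alpha> \<noteq> 0 \<Longrightarrow> reflection \<alpha> (reflection \<alpha> x) = x"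
  by (subst (1) reflection_def) (simp add: inner_reflection_root, simp add: reflection_def)

lemma reflection_self: "\<alpha> \<noteq> 0 \<Longrightarrow> reflection \<alpha> \<alpha> = - \<alpha>"
  by (simp add: reflection_def power2_norm_eq_inner algebra_simps scaleR_2)

lemma reflection_minus: "reflection \<alpha> (- x) = - reflection \<alpha> x"
  by (simp add: reflection_def)

lemma linear_reflection: "linear (reflection \<alpha>)"
  by (rule linearI) (simp_all add: reflection_def inner_add_left add_divide_distrib algebra_simps)

lemma orthogonal_transformation_reflection: "\<alpha> \<noteq> 0 \<Longrightarrow> orthogonal_transformation (reflection \<alpha>)"
  by (simp add: orthogonal_transformation_def linear_reflection inner_reflection_swap reflection_reflection)

lemma continuous_on_reflection [continuous_intros]:
  "continuous_on S f \<Longrightarrow> continuous_on S (\<lambda>x. reflection \<alpha> (f x))"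
  unfolding reflection_def divide_inverse by (intro continuous_intros)

lemma borel_measurable_reflection [measurable]: "reflection \<alpha> \<in> borel_measurable borel"
  by (intro borel_measurable_continuous_onI continuous_intros)

text \<open>Finitely many hyperplanes form a null set and cannot fill the space.\<close>

lemma exists_vector_off_hyperplanes:
  fixes A :: "'a::euclidean_space set"
  assumes "finite A" "0 \<notin> A"
  shows "\<exists>v. \<forall>a\<in>A. a \<bullet> v \<noteq> 0"
proof (rule ccontr)
  assume "\<nexists>v. \<forall>a\<in>A. a \<bullet> v \<noteq> 0"
  then have "UNIV = \<Union> ((\<lambda>a. {v. a \<bullet> v = 0}) ` A)" by auto
  moreover have "negligible (\<Union> ((\<lambda>a. {v. a \<bullet> v = 0}) ` A))"
    using assms by (intro negligible_Union) (auto intro!: negligible_hyperplane)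
  ultimately show False by (metis non_negligible_UNIV)
qed

locale root_data =
  fixes R Rp :: "'a::euclidean_space set" and k :: "'a \<Rightarrow> real"
  assumes root_system: "root_system R"
    and positive: "positive_subsystem R Rp"
    and multiplicity: "multiplicity_function R k"
begin

lemma finite_Rp: "finite Rp"
  and Rp_subset: "Rp \<subseteq> R"
  and Rp_nonzero: "\<alpha> \<in> Rp \<Longrightarrow> \<alpha> \<noteq> 0"
  using root_system positive by (auto simp: root_system_def positive_subsystem_def)

lemma uminus_R: "\<alpha> \<in> R \<Longrightarrow> - \<alpha> \<in> R"
  using root_system by (auto simp: root_system_def)

lemma reflection_R: "\<alpha> \<in> R \<Longrightarrow> \<beta> \<in> R \<Longrightarrow> reflection \<alpha> \<beta> \<in> R"
  using root_system by (auto simp: root_system_def)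

lemma Rp_or_uminus: "\<alpha> \<in> R \<Longrightarrow> \<alpha> \<in> Rp \<longleftrightarrow> - \<alpha> \<notin> Rp"
  using positive uminus_R[of \<alpha>] by (force simp: positive_subsystem_def)

lemma Rp_not_parallel: "\<alpha> \<in> Rp \<Longrightarrow> \<beta> \<in> Rp \<Longrightarrow> \<alpha> \<noteq> \<beta> \<Longrightarrow> \<beta> \<noteq> c *\<^sub>R \<alpha>"
proof
  assume *: "\<alpha> \<in> Rp" "\<beta> \<in> Rp" "\<alpha> \<noteq> \<beta>" "\<beta> = c *\<^sub>R \<alpha>"
  then have "\<beta> \<in> R \<inter> range (\<lambda>c. c *\<^sub>R \<alpha>)" using Rp_subset by auto
  also have "\<dots> = {\<alpha>, - \<alpha>}" using root_system * Rp_subset by (auto simp: root_system_def)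
  finally show False using * Rp_or_uminus[of \<alpha>] Rp_subset by auto
qed

lemma k_nonneg: "\<alpha> \<in> Rp \<Longrightarrow> 0 \<le> k \<alpha>"
  using multiplicity Rp_subset by (auto simp: multiplicity_function_def)

lemma k_reflection: "\<alpha> \<in> R \<Longrightarrow> \<beta> \<in> R \<Longrightarrow> k (reflection \<alpha> \<beta>) = k \<beta>"
  using multiplicity reflection_group.comp[OF reflection_group.id, of \<alpha> R]
  by (auto simp: multiplicity_function_def)

lemma k_uminus: "\<beta> \<in> R \<Longrightarrow> k (- \<beta>) = k \<beta>"
proof -
  assume "\<beta> \<in> R"
  moreover from this have "\<beta> \<noteq> 0" using root_system by (auto simp: root_system_def)
  ultimately show ?thesis using k_reflection[of \<beta> \<beta>] reflection_self[of \<beta>] by simp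
qed

text \<open>A reflection permutes the roots but need not preserve \<open>Rp\<close>. Choosing the
  positive one of each pair of opposite roots gives the induced permutation of \<open>Rp\<close>,
  along which expressions insensitive to the sign of a root can be reindexed.\<close>

definition pos_reflect :: "'a \<Rightarrow> 'a \<Rightarrow> 'a" where
  "pos_reflect \<alpha> \<beta> = (if reflection \<alpha> \<beta> \<in> Rp then reflection \<alpha> \<beta> else - reflection \<alpha> \<beta>)"

lemma
  assumes "\<alpha> \<in> Rp" "\<beta> \<in> Rp"
  shows pos_reflect_mem: "pos_reflect \<alpha> \<beta> \<in> Rp"
    and k_pos_reflect: "k (pos_reflect \<alpha> \<beta>) = k \<beta>"
    and pos_reflect_invol: "pos_reflect \<alpha> (pos_reflect \<alpha> \<beta>) = \<beta>"
proof -
  have R: "\<alpha> \<in> R" "\<beta> \<in> R" "reflection \<alpha> \<beta> \<in> R" using assms Rp_subset reflection_R by auto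
  show "pos_reflect \<alpha> \<beta> \<in> Rp" using Rp_or_uminus[OF R(3)] by (simp add: pos_reflect_def)
  show "k (pos_reflect \<alpha> \<beta>) = k \<beta>" using R by (simp add: pos_reflect_def k_reflection k_uminus)
  show "pos_reflect \<alpha> (pos_reflect \<alpha> \<beta>) = \<beta>"
    using assms R Rp_or_uminus[OF R(2)]
    by (auto simp: pos_reflect_def reflection_minus reflection_reflection[OF Rp_nonzero])
qed

lemma pos_reflect_self: "\<alpha> \<in> Rp \<Longrightarrow> pos_reflect \<alpha> \<alpha> = \<alpha>"
  using Rp_subset Rp_or_uminus[of \<alpha>] by (auto simp: pos_reflect_def reflection_self Rp_nonzero)

lemma abs_inner_pos_reflect: "\<bar>x \<bullet> pos_reflect \<alpha> \<beta>\<bar> = \<bar>reflection \<alpha> x \<bullet> \<beta>\<bar>"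
  by (simp add: pos_reflect_def inner_reflection_swap)

lemma bij_betw_pos_reflect: "\<alpha> \<in> Rp \<Longrightarrow> bij_betw (pos_reflect \<alpha>) Rp Rp"
  by (rule bij_betwI[where g="pos_reflect \<alpha>"]) (auto simp: pos_reflect_mem pos_reflect_invol)

lemma dunkl_weight_reflection:
  assumes "\<alpha> \<in> Rp"
  shows "dunkl_weight Rp k (reflection \<alpha> x) = dunkl_weight Rp k x"
  unfolding dunkl_weight_def
  by (subst (2) prod.reindex_bij_betw[OF bij_betw_pos_reflect[OF assms], symmetric])
    (simp add: abs_inner_pos_reflect k_pos_reflect assms)

text \<open>On the hyperplane of \<alpha> the reflection fixes \<open>y\<close>. Reindexing by
  \<open>pos_reflect\<close> keeps \<open>k\<close> and flips the sign of \<alpha> \<bullet> \<beta>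
  relative to \<open>y\<close> \<bullet> \<beta>; the sign choice in \<open>pos_reflect\<close>
  cancels in the quotient. The sum therefore equals its own negative.\<close>

lemma sum_root_residue_eq_0:
  assumes \<alpha>: "\<alpha> \<in> Rp" and y: "y \<bullet> \<alpha> = 0"
  shows "(\<Sum>\<beta>\<in>Rp - {\<alpha>}. k \<beta> * (\<alpha> \<bullet> \<beta>) / (y \<bullet> \<beta>)) = 0" (is "sum ?f _ = 0")
proof -
  have "bij_betw (pos_reflect \<alpha>) (Rp - {\<alpha>}) (Rp - {\<alpha>})"
    using bij_betw_DiffI[OF bij_betw_pos_reflect[OF \<alpha>], of "{\<alpha>}" "{\<alpha>}"] pos_reflect_self[OF \<alpha>] \<alpha>
    by (auto simp: bij_betw_def)
  then have "sum ?f (Rp - {\<alpha>}) = (\<Sum>\<beta>\<in>Rp - {\<alpha>}. ?f (pos_reflect \<alpha> \<beta>))"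
    by (rule sum.reindex_bij_betw[symmetric])
  also have "\<dots> = (\<Sum>\<beta>\<in>Rp - {\<alpha>}. - ?f \<beta>)"
  proof (rule sum.cong)
    fix \<beta> assume b: "\<beta> \<in> Rp - {\<alpha>}"
    have "\<alpha> \<bullet> reflection \<alpha> \<beta> = - (\<alpha> \<bullet> \<beta>)" "y \<bullet> reflection \<alpha> \<beta> = y \<bullet> \<beta>"
      using inner_reflection_root[OF Rp_nonzero[OF \<alpha>], of \<beta>] inner_reflection_left[of \<alpha> y \<beta>] y
      by (simp_all add: inner_commute[of \<alpha>] inner_reflection_swap)
    then show "?f (pos_reflect \<alpha> \<beta>) = - ?f \<beta>"
      using k_pos_reflect[OF \<alpha>, of \<beta>] b by (simp add: pos_reflect_def)
  qed simp
  finally show ?thesis by (simp add: sum_negf)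
qed

text \<open>Along a generic line \<open>x + t v\<close> the double sum is a rational function of \<open>t\<close> vanishing at
  infinity with simple poles, and the residues vanish by reflection symmetry. The partial fraction
  decomposition at \<open>t = 0\<close> is written out explicitly.\<close>

lemma sum_cross_terms_eq_0:
  assumes x: "\<And>\<alpha>. \<alpha> \<in> Rp \<Longrightarrow> x \<bullet> \<alpha> \<noteq> 0"
  shows "(\<Sum>\<alpha>\<in>Rp. \<Sum>\<beta>\<in>Rp - {\<alpha>}. k \<alpha> * k \<beta> * (\<alpha> \<bullet> \<beta>) / ((x \<bullet> \<alpha>) * (x \<bullet> \<beta>))) = 0"
proof -
  \<comment> \<open>If \<open>v\<close> is orthogonal to neither root, then
    \<open>w \<alpha> \<beta>\<close> \<bullet> \<open>v\<close> is nonzero exactly when the line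
    \<open>x + t v\<close> meets the two root hyperplanes at different parameters. Avoiding the
    hyperplanes of the vectors \<open>w \<alpha> \<beta>\<close> thus makes all poles
    simple.\<close>
  define w where "w \<alpha> \<beta> = (x \<bullet> \<beta>) *\<^sub>R \<alpha> - (x \<bullet> \<alpha>) *\<^sub>R \<beta>" for \<alpha> \<beta>
  have w0: "w \<alpha> \<beta> \<noteq> 0" if "\<alpha> \<in> Rp" "\<beta> \<in> Rp" "\<alpha> \<noteq> \<beta>" for \<alpha> \<beta>
  proof
    assume "w \<alpha> \<beta> = 0"
    then have "(1 / (x \<bullet> \<alpha>)) *\<^sub>R ((x \<bullet> \<alpha>) *\<^sub>R \<beta>) = (1 / (x \<bullet> \<alpha>)) *\<^sub>R ((x \<bullet> \<beta>) *\<^sub>R \<alpha>)"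
      by (simp add: w_def)
    then have "\<beta> = ((x \<bullet> \<beta>) / (x \<bullet> \<alpha>)) *\<^sub>R \<alpha>"
      using x[OF that(1)] by simp
    then show False using Rp_not_parallel that by blast
  qed
  define A where "A = Rp \<union> (\<lambda>(\<alpha>, \<beta>). w \<alpha> \<beta>) ` {(\<alpha>, \<beta>) \<in> Rp \<times> Rp. \<alpha> \<noteq> \<beta>}"
  have "finite {(\<alpha>, \<beta>) \<in> Rp \<times> Rp. \<alpha> \<noteq> \<beta>}"
    by (rule finite_subset[OF _ finite_cartesian_product[OF finite_Rp finite_Rp]]) auto
  then have finA: "finite A"
    using finite_Rp by (simp add: A_def)
  have "0 \<notin> A"
  proof
    assume "0 \<in> A"
    then obtain p where "p \<in> {(\<alpha>, \<beta>) \<in> Rp \<times> Rp. \<alpha> \<noteq> \<beta>}" "0 = (case p of (\<alpha>, \<beta>) \<Rightarrow> w \<alpha> \<beta>)"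
      unfolding A_def using Rp_nonzero[of 0] by (elim UnE imageE) simp_all
    then show False using w0[of "fst p" "snd p"] by (simp add: case_prod_unfold)
  qed
  then obtain v where v: "\<And>a. a \<in> A \<Longrightarrow> a \<bullet> v \<noteq> 0"
    using exists_vector_off_hyperplanes[OF finA] by blast
  \<comment> \<open>\<open>y \<alpha>\<close> is the point where the line meets the hyperplane of
    \<alpha>, and \<open>g \<alpha> \<beta>\<close> is the value at \<open>t = 0\<close> of the
    partial fraction belonging to that pole.\<close>
  define y where "y \<alpha> = x - ((x \<bullet> \<alpha>) / (v \<bullet> \<alpha>)) *\<^sub>R v" for \<alpha>
  define g where "g \<alpha> \<beta> = k \<alpha> / (x \<bullet> \<alpha>) * (k \<beta> * (\<alpha> \<bullet> \<beta>) / (y \<alpha> \<bullet> \<beta>))" for \<alpha> \<beta>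
  have split: "k \<alpha> * k \<beta> * (\<alpha> \<bullet> \<beta>) / ((x \<bullet> \<alpha>) * (x \<bullet> \<beta>)) = g \<alpha> \<beta> + g \<beta> \<alpha>"
    if \<alpha>: "\<alpha> \<in> Rp" and \<beta>: "\<beta> \<in> Rp - {\<alpha>}" for \<alpha> \<beta>
  proof -
    define a b p r where "a = x \<bullet> \<alpha>" and "b = x \<bullet> \<beta>" and "p = v \<bullet> \<alpha>" and "r = v \<bullet> \<beta>"
    have nz: "a \<noteq> 0" "b \<noteq> 0" "p \<noteq> 0" "r \<noteq> 0"
      using x \<alpha> \<beta> v[of \<alpha>] v[of \<beta>] by (auto simp: a_def b_def p_def r_def A_def inner_commute)
    have "w \<alpha> \<beta> \<in> A" using \<alpha> \<beta> by (auto simp: A_def)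
    from v[OF this] have d: "b * p - a * r \<noteq> 0"
      by (simp add: w_def inner_diff_left a_def b_def p_def r_def inner_commute[of v])
    have ya: "y \<alpha> \<bullet> \<beta> = (b * p - a * r) / p" "y \<beta> \<bullet> \<alpha> = - (b * p - a * r) / r"
      using nz by (simp_all add: y_def inner_diff_left a_def b_def p_def r_def field_simps)
    have "1 / (a * b) = 1 / (a * (y \<alpha> \<bullet> \<beta>)) + 1 / (b * (y \<beta> \<bullet> \<alpha>))"
      unfolding ya using nz d by (simp add: divide_simps) (simp add: algebra_simps)
    then have "k \<alpha> * k \<beta> * (\<alpha> \<bullet> \<beta>) * (1 / (a * b))
        = k \<alpha> * k \<beta> * (\<alpha> \<bullet> \<beta>) * (1 / (a * (y \<alpha> \<bullet> \<beta>)) + 1 / (b * (y \<beta> \<bullet> \<alpha>)))" by simp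
    then show ?thesis by (simp add: g_def a_def b_def inner_commute distrib_left mult_ac)
  qed
  have s0: "(\<Sum>\<alpha>\<in>Rp. \<Sum>\<beta>\<in>Rp - {\<alpha>}. g \<alpha> \<beta>) = 0"
  proof (rule sum.neutral, rule ballI)
    fix \<alpha> assume \<alpha>: "\<alpha> \<in> Rp"
    have "y \<alpha> \<bullet> \<alpha> = 0"
      using v[of \<alpha>] \<alpha> by (simp add: y_def inner_diff_left A_def inner_commute[of v])
    from sum_root_residue_eq_0[OF \<alpha> this]
    show "(\<Sum>\<beta>\<in>Rp - {\<alpha>}. g \<alpha> \<beta>) = 0"
      unfolding g_def sum_distrib_left[symmetric] by simp
  qed
  have "(\<Sum>\<alpha>\<in>Rp. \<Sum>\<beta>\<in>Rp - {\<alpha>}. g \<beta> \<alpha>) = (\<Sum>\<beta>\<in>Rp. \<Sum>\<alpha>\<in>Rp - {\<beta>}. g \<beta> \<alpha>)"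
    using sum.swap_restrict[OF finite_Rp finite_Rp, of "\<lambda>\<alpha> \<beta>. g \<beta> \<alpha>" "\<lambda>\<alpha> \<beta>. \<alpha> \<noteq> \<beta>"]
    by (simp add: set_diff_eq neq_commute)
  then show ?thesis
    using s0 by (simp add: split sum.distrib)
qed

text \<open>Both sides are the squared norm of the vector \<open>V\<close>, the gradient of
  \<open>log s\<close>. Expanding \<open>V\<close> \<bullet> \<open>V\<close> over pairs of roots,
  the diagonal pairs give the right-hand side and the others sum to zero.\<close>

lemma sum_Basis_log_gradient:
  assumes x: "\<And>\<alpha>. \<alpha> \<in> Rp \<Longrightarrow> x \<bullet> \<alpha> \<noteq> 0"
  shows "(\<Sum>b\<in>Basis. (\<Sum>\<alpha>\<in>Rp. k \<alpha> * (b \<bullet> \<alpha>) / (x \<bullet> \<alpha>))\<^sup>2)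
    = (\<Sum>\<alpha>\<in>Rp. (norm \<alpha> * k \<alpha> / (x \<bullet> \<alpha>))\<^sup>2)"
proof -
  define V where "V = (\<Sum>\<alpha>\<in>Rp. (k \<alpha> / (x \<bullet> \<alpha>)) *\<^sub>R \<alpha>)"
  have "(\<Sum>b\<in>Basis. (\<Sum>\<alpha>\<in>Rp. k \<alpha> * (b \<bullet> \<alpha>) / (x \<bullet> \<alpha>))\<^sup>2) = (\<Sum>b\<in>Basis. (V \<bullet> b) * (V \<bullet> b))"
  proof (rule sum.cong)
    fix b :: 'a
    have "(\<Sum>\<alpha>\<in>Rp. k \<alpha> * (b \<bullet> \<alpha>) / (x \<bullet> \<alpha>)) = V \<bullet> b"
      unfolding V_def inner_sum_left by (intro sum.cong) (simp_all add: inner_commute[of b])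
    then show "(\<Sum>\<alpha>\<in>Rp. k \<alpha> * (b \<bullet> \<alpha>) / (x \<bullet> \<alpha>))\<^sup>2 = (V \<bullet> b) * (V \<bullet> b)"
      by (simp add: power2_eq_square)
  qed simp
  also have "\<dots> = V \<bullet> V"
    by (rule euclidean_inner[symmetric])
  also have "\<dots> = (\<Sum>\<alpha>\<in>Rp. \<Sum>\<beta>\<in>Rp. k \<alpha> * k \<beta> * (\<alpha> \<bullet> \<beta>) / ((x \<bullet> \<alpha>) * (x \<bullet> \<beta>)))"
    unfolding V_def inner_sum_left inner_sum_right inner_scaleR_left inner_scaleR_right sum_distrib_left
    by (intro sum.cong) (simp_all add: inner_commute)
  also have "\<dots> = (\<Sum>\<alpha>\<in>Rp. (norm \<alpha> * k \<alpha> / (x \<bullet> \<alpha>))\<^sup>2 + (\<Sum>\<beta>\<in>Rp - {\<alpha>}. k \<alpha> * k \<beta> * (\<alpha> \<bullet> \<beta>) / ((x \<bullet> \<alpha>) * (x \<bullet> \<beta>))))"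
  proof (intro sum.cong refl)
    fix \<alpha> assume "\<alpha> \<in> Rp"
    moreover have "(norm \<alpha> * k \<alpha> / (x \<bullet> \<alpha>))\<^sup>2 = k \<alpha> * k \<alpha> * (\<alpha> \<bullet> \<alpha>) / ((x \<bullet> \<alpha>) * (x \<bullet> \<alpha>))"
      unfolding power_divide power_mult_distrib power2_norm_eq_inner by (simp add: power2_eq_square)
    ultimately show "(\<Sum>\<beta>\<in>Rp. k \<alpha> * k \<beta> * (\<alpha> \<bullet> \<beta>) / ((x \<bullet> \<alpha>) * (x \<bullet> \<beta>)))
      = (norm \<alpha> * k \<alpha> / (x \<bullet> \<alpha>))\<^sup>2 + (\<Sum>\<beta>\<in>Rp - {\<alpha>}. k \<alpha> * k \<beta> * (\<alpha> \<bullet> \<beta>) / ((x \<bullet> \<alpha>) * (x \<bullet> \<beta>)))"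
      by (subst sum.remove[OF finite_Rp, of \<alpha>]) simp_all
  qed
  finally show ?thesis
    by (simp add: sum.distrib sum_cross_terms_eq_0[OF x])
qed

end

section \<open>Conjugation with the weight on a Weyl chamber\<close>

lemma
  fixes f :: "'a::euclidean_space \<Rightarrow> real"
  assumes \<alpha>: "\<alpha> \<noteq> 0" and f: "integrable lborel f"
  shows integrable_lborel_reflection: "integrable lborel (\<lambda>x. f (reflection \<alpha> x))"
    and integral_lborel_reflection: "(LINT x|lborel. f (reflection \<alpha> x)) = (LINT x|lborel. f x)"
proof -
  have d: "distr lborel borel (reflection \<alpha>) = lborel"
    by (rule lborel_distr_orthogonal[OF orthogonal_transformation_reflection[OF \<alpha>]])
  have [measurable]: "f \<in> borel_measurable borel" using f by auto
  show "integrable lborel (\<lambda>x. f (reflection \<alpha> x))"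
    using f integrable_distr_eq[of "reflection \<alpha>" lborel borel f] by (simp add: d)
  show "(LINT x|lborel. f (reflection \<alpha> x)) = (LINT x|lborel. f x)"
    using integral_distr[of "reflection \<alpha>" lborel borel f] by (simp add: d)
qed

lemma borel_measurable_dunkl_weight [measurable]: "dunkl_weight Rp k \<in> borel_measurable borel"
  unfolding dunkl_weight_def[abs_def] by measurable

text \<open>Connectedness is required of \<open>U\<close> and not of \<open>D\<close>. It places all
  components of \<open>D\<close> in one Weyl chamber, so a reflection cannot carry one component
  onto another.\<close>

locale chamber = root_data +
  fixes D U :: "'a set"
  assumes open_D: "open D" and bounded_D: "bounded D"
    and open_U: "open U" and connected_U: "connected U" and closure_D: "closure D \<subseteq> U"
    and no_hyperplane: "U \<inter> (\<Union>\<alpha>\<in>Rp. root_hyperplane \<alpha>) = {}"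
begin

definition s :: "'a \<Rightarrow> real" where "s x = sqrt (dunkl_weight Rp k x)"

definition potential :: "'a \<Rightarrow> real" where
  "potential x = (\<Sum>\<alpha>\<in>Rp. (norm \<alpha> * k \<alpha> / (x \<bullet> \<alpha>))\<^sup>2)"

text \<open>The rate of the jump from \<open>x\<close> to its mirror image: the factor 2 in front of
  the sum in the Dunkl Laplacian cancels the 1/2 of the difference term.\<close>

definition jump :: "'a \<Rightarrow> 'a \<Rightarrow> real" where
  "jump \<alpha> x = (norm \<alpha>)\<^sup>2 * k \<alpha> / (x \<bullet> \<alpha>)\<^sup>2"

text \<open>The nonlocal part of the Dunkl operator that looks out of \<open>D\<close>, multiplied
  by \<open>s\<close>; for \<open>x\<close> in \<open>D\<close> it evaluates \<open>f\<close> only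
  at points outside \<open>D\<close>.\<close>

definition source :: "('a \<Rightarrow> real) \<Rightarrow> 'a \<Rightarrow> real" where
  "source f x = s x * (\<Sum>\<alpha>\<in>Rp. jump \<alpha> x * f (reflection \<alpha> x))"

lemma D_subset: "D \<subseteq> closure D" "D \<subseteq> U" "closure D \<subseteq> U" "frontier D \<subseteq> U"
  using closure_D closure_subset[of D] by (auto simp: frontier_def)

lemma compact_closure_D: "compact (closure D)"
  using bounded_D by (simp add: compact_closure)

lemma inner_nonzero: "x \<in> U \<Longrightarrow> \<alpha> \<in> Rp \<Longrightarrow> x \<bullet> \<alpha> \<noteq> 0"
  using no_hyperplane by (auto simp: root_hyperplane_def)

text \<open>A change of sign on the connected set \<open>U\<close> would produce a zero of the
  linear form, that is, a point on the hyperplane of \<alpha>.\<close>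

lemma chamber_sign:
  assumes "\<alpha> \<in> Rp" shows "(\<forall>x\<in>U. 0 < x \<bullet> \<alpha>) \<or> (\<forall>x\<in>U. x \<bullet> \<alpha> < 0)"
proof (rule ccontr)
  assume "\<not> ?thesis"
  then obtain x y where "x \<in> U" "y \<in> U" "\<alpha> \<bullet> x \<le> 0" "0 \<le> \<alpha> \<bullet> y" by (auto simp: not_less inner_commute)
  from connected_ivt_hyperplane[OF connected_U this] show False
    using inner_nonzero assms by (auto simp: inner_commute)
qed

lemma reflection_notin_U: "x \<in> U \<Longrightarrow> \<alpha> \<in> Rp \<Longrightarrow> reflection \<alpha> x \<notin> U"
proof
  assume *: "x \<in> U" "\<alpha> \<in> Rp" "reflection \<alpha> x \<in> U"
  have "reflection \<alpha> x \<bullet> \<alpha> = - (x \<bullet> \<alpha>)"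
    by (rule inner_reflection_root[OF Rp_nonzero[OF *(2)]])
  moreover have "0 < x \<bullet> \<alpha> \<and> 0 < reflection \<alpha> x \<bullet> \<alpha> \<or> x \<bullet> \<alpha> < 0 \<and> reflection \<alpha> x \<bullet> \<alpha> < 0"
    using chamber_sign[OF *(2)] *(1,3) by blast
  ultimately show False by linarith
qed

text \<open>Covering boundary points as well is what makes \<open>source f\<close> continuous up to
  the boundary when \<open>f\<close> is controlled only outside \<open>D\<close>.\<close>

lemma reflection_notin_D: "x \<in> closure D \<Longrightarrow> \<alpha> \<in> Rp \<Longrightarrow> reflection \<alpha> x \<notin> D"
  using reflection_notin_U[of x \<alpha>] D_subset(2,3) by blast

lemma s_eq: "s x = (\<Prod>\<alpha>\<in>Rp. \<bar>x \<bullet> \<alpha>\<bar> powr k \<alpha>)"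
proof -
  have "dunkl_weight Rp k x = (\<Prod>\<alpha>\<in>Rp. \<bar>x \<bullet> \<alpha>\<bar> powr k \<alpha>)\<^sup>2"
    unfolding dunkl_weight_def power2_eq_square prod.distrib[symmetric] powr_add[symmetric] by simp
  then show ?thesis
    by (simp add: s_def prod_nonneg)
qed

lemma s_pos: "x \<in> U \<Longrightarrow> 0 < s x"
  unfolding s_eq by (rule prod_pos) (use inner_nonzero in auto)

lemma s_nonneg: "0 \<le> s x"
  unfolding s_eq by (rule prod_nonneg) auto

lemma s_square: "s x * s x = dunkl_weight Rp k x"
  by (simp add: s_def dunkl_weight_def prod_nonneg)

lemma s_reflection: "\<alpha> \<in> Rp \<Longrightarrow> s (reflection \<alpha> x) = s x"
  by (simp add: s_def dunkl_weight_reflection)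

lemma borel_measurable_s [measurable]: "s \<in> borel_measurable borel"
  unfolding s_def[abs_def] by measurable

lemma jump_reflection: "\<alpha> \<in> Rp \<Longrightarrow> jump \<alpha> (reflection \<alpha> x) = jump \<alpha> x"
  by (simp add: jump_def inner_reflection_root[OF Rp_nonzero])

lemma jump_nonneg: "\<alpha> \<in> Rp \<Longrightarrow> 0 \<le> jump \<alpha> x"
  by (simp add: jump_def k_nonneg)

lemma borel_measurable_jump [measurable]: "jump \<alpha> \<in> borel_measurable borel"
  unfolding jump_def[abs_def] by measurable

lemma continuous_on_jump: "\<alpha> \<in> Rp \<Longrightarrow> continuous_on U (jump \<alpha>)"
  unfolding jump_def[abs_def] using inner_nonzero by (intro continuous_intros) auto

lemma continuous_on_potential: "continuous_on U potential"
  unfolding potential_def[abs_def] using inner_nonzero by (intro continuous_intros) auto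

text \<open>With suitable signs the absolute values in the weight become positive linear forms on
  \<open>U\<close>, so that \<open>s\<close> is a product of smooth powers there.\<close>

lemma chamber_signs:
  obtains c :: "'a \<Rightarrow> real" where "\<And>\<alpha> x. \<alpha> \<in> Rp \<Longrightarrow> x \<in> U \<Longrightarrow> 0 < x \<bullet> (c \<alpha> *\<^sub>R \<alpha>)"
    "\<And>\<alpha> x. \<alpha> \<in> Rp \<Longrightarrow> x \<in> U \<Longrightarrow> \<bar>x \<bullet> \<alpha>\<bar> = x \<bullet> (c \<alpha> *\<^sub>R \<alpha>)" "\<And>\<alpha>. c \<alpha> \<noteq> 0"
proof
  define c :: "'a \<Rightarrow> real" where "c \<alpha> = (if \<forall>x\<in>U. 0 < x \<bullet> \<alpha> then 1 else - 1)" for \<alpha>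
  show "0 < x \<bullet> (c \<alpha> *\<^sub>R \<alpha>)" "\<bar>x \<bullet> \<alpha>\<bar> = x \<bullet> (c \<alpha> *\<^sub>R \<alpha>)" if "\<alpha> \<in> Rp" "x \<in> U" for \<alpha> x
    using chamber_sign[OF that(1)] that(2) by (auto simp: c_def less_imp_le)
  show "c \<alpha> \<noteq> 0" for \<alpha> by (simp add: c_def)
qed

lemma C_k_on_s: "C_k_on n U s" "C_k_on n U (\<lambda>x. inverse (s x))"
proof -
  obtain c where c: "\<And>\<alpha> x. \<alpha> \<in> Rp \<Longrightarrow> x \<in> U \<Longrightarrow> 0 < x \<bullet> (c \<alpha> *\<^sub>R \<alpha>)"
    "\<And>\<alpha> x. \<alpha> \<in> Rp \<Longrightarrow> x \<in> U \<Longrightarrow> \<bar>x \<bullet> \<alpha>\<bar> = x \<bullet> (c \<alpha> *\<^sub>R \<alpha>)" by (rule chamber_signs) blast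
  have C: "C_k_on n U (\<lambda>x. \<Prod>\<alpha>\<in>Rp. (x \<bullet> (c \<alpha> *\<^sub>R \<alpha>)) powr e \<alpha>)" for e :: "'a \<Rightarrow> real"
    by (intro C_k_on_prod C_k_on_inner_powr open_U c(1))
  have "s x = (\<Prod>\<alpha>\<in>Rp. (x \<bullet> (c \<alpha> *\<^sub>R \<alpha>)) powr k \<alpha>)"
    "inverse (s x) = (\<Prod>\<alpha>\<in>Rp. (x \<bullet> (c \<alpha> *\<^sub>R \<alpha>)) powr (- k \<alpha>))" if "x \<in> U" for x
    using c(2)[OF _ that] by (simp_all add: s_eq powr_minus flip: prod_inversef cong: prod.cong)
  then show "C_k_on n U s" "C_k_on n U (\<lambda>x. inverse (s x))"
    using C C_k_on_cong[OF open_U, of s] C_k_on_cong[OF open_U, of "\<lambda>x. inverse (s x)"] by auto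
qed

lemma continuous_on_s: "continuous_on U s"
  using C_k_on_imp_continuous_on[OF C_k_on_s(1)[of 0]] .

definition log_grad :: "'a \<Rightarrow> 'a \<Rightarrow> real" where
  "log_grad b x = (\<Sum>\<alpha>\<in>Rp. k \<alpha> * (b \<bullet> \<alpha>) / (x \<bullet> \<alpha>))"

text \<open>On \<open>U\<close> the function is the exponential of a sum of logarithms, so
  differentiation proceeds root by root.\<close>

lemma has_derivative_s:
  assumes "x \<in> U" shows "(s has_derivative (\<lambda>h. s x * log_grad h x)) (at x)"
proof -
  obtain c where c: "\<And>\<alpha> x. \<alpha> \<in> Rp \<Longrightarrow> x \<in> U \<Longrightarrow> 0 < x \<bullet> (c \<alpha> *\<^sub>R \<alpha>)"
    "\<And>\<alpha> x. \<alpha> \<in> Rp \<Longrightarrow> x \<in> U \<Longrightarrow> \<bar>x \<bullet> \<alpha>\<bar> = x \<bullet> (c \<alpha> *\<^sub>R \<alpha>)" "\<And>\<alpha>. c \<alpha> \<noteq> 0" by (rule chamber_signs) blast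
  have e: "exp (\<Sum>\<alpha>\<in>Rp. k \<alpha> * ln (y \<bullet> (c \<alpha> *\<^sub>R \<alpha>))) = s y" if "y \<in> U" for y
    unfolding s_eq exp_sum[OF finite_Rp]
  proof (rule prod.cong)
    fix \<alpha> assume "\<alpha> \<in> Rp"
    then show "exp (k \<alpha> * ln (y \<bullet> (c \<alpha> *\<^sub>R \<alpha>))) = \<bar>y \<bullet> \<alpha>\<bar> powr k \<alpha>"
      using c(1)[OF _ that, of \<alpha>] c(2)[OF _ that, of \<alpha>] by (auto simp: powr_def)
  qed simp
  have "((\<lambda>y. exp (\<Sum>\<alpha>\<in>Rp. k \<alpha> * ln (y \<bullet> (c \<alpha> *\<^sub>R \<alpha>)))) has_derivative
      (\<lambda>h. (\<Sum>\<alpha>\<in>Rp. k \<alpha> * (inverse (x \<bullet> (c \<alpha> *\<^sub>R \<alpha>)) * (h \<bullet> (c \<alpha> *\<^sub>R \<alpha>)))) * exp (\<Sum>\<alpha>\<in>Rp. k \<alpha> * ln (x \<bullet> (c \<alpha> *\<^sub>R \<alpha>))))) (at x)"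
    using c(1)[OF _ assms] by (auto intro!: derivative_eq_intros simp: mult_ac divide_inverse)
  moreover have "(\<Sum>\<alpha>\<in>Rp. k \<alpha> * (inverse (x \<bullet> (c \<alpha> *\<^sub>R \<alpha>)) * (h \<bullet> (c \<alpha> *\<^sub>R \<alpha>)))) = log_grad h x" for h
    unfolding log_grad_def using c(3) by (intro sum.cong) (simp_all add: divide_inverse)
  ultimately show ?thesis
    using has_derivative_transform_within_open[OF _ open_U assms e] e[OF assms] by (simp add: mult.commute)
qed

lemma frechet_derivative_s: "x \<in> U \<Longrightarrow> frechet_derivative s (at x) b = s x * log_grad b x"
  using fun_cong[OF frechet_derivative_at[OF has_derivative_s], of x b] by simp

text \<open>The cross terms of \<open>\<bar>\<nabla> log s\<bar>\<^sup>2\<close> cancel, which leaves \<open>potential\<close>.\<close>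

lemma laplacian_s:
  assumes x: "x \<in> U" shows "laplacian s x = s x * (potential x - (\<Sum>\<alpha>\<in>Rp. jump \<alpha> x))"
proof -
  have nz: "x \<bullet> \<alpha> \<noteq> 0" if "\<alpha> \<in> Rp" for \<alpha> using inner_nonzero x that by auto
  \<comment> \<open>This is the rule that the second derivative of \<open>s\<close> is
    \<open>s\<close> times the square of the first derivative of \<open>log s\<close> plus its
    second derivative, in direction \<open>b\<close>.\<close>
  have "frechet_derivative (\<lambda>y. frechet_derivative s (at y) b) (at x) b
      = s x * (log_grad b x)\<^sup>2 - s x * (\<Sum>\<alpha>\<in>Rp. k \<alpha> * (b \<bullet> \<alpha>)\<^sup>2 / (x \<bullet> \<alpha>)\<^sup>2)" for b
  proof -
    have L: "((\<lambda>y. log_grad b y) has_derivative (\<lambda>h. - (\<Sum>\<alpha>\<in>Rp. k \<alpha> * (b \<bullet> \<alpha>) * (h \<bullet> \<alpha>) / (x \<bullet> \<alpha>)\<^sup>2))) (at x)"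
      unfolding log_grad_def using nz
      by (auto intro!: derivative_eq_intros simp: sum_negf[symmetric] power2_eq_square divide_inverse mult_ac intro!: sum.cong ext)
    have "((\<lambda>y. s y * log_grad b y) has_derivative
      (\<lambda>h. s x * - (\<Sum>\<alpha>\<in>Rp. k \<alpha> * (b \<bullet> \<alpha>) * (h \<bullet> \<alpha>) / (x \<bullet> \<alpha>)\<^sup>2) + s x * log_grad h x * log_grad b x)) (at x)"
      by (rule has_derivative_mult[OF has_derivative_s[OF x] L])
    note fun_cong[OF frechet_derivative_at[OF this], of b]
    moreover have "frechet_derivative (\<lambda>y. frechet_derivative s (at y) b) (at x) = frechet_derivative (\<lambda>y. s y * log_grad b y) (at x)"
      by (rule frechet_derivative_cong_open(1)[OF open_U x]) (rule frechet_derivative_s)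
    ultimately show ?thesis by (simp add: power2_eq_square mult_ac)
  qed
  then have "laplacian s x = s x * (\<Sum>b\<in>Basis. (log_grad b x)\<^sup>2) - s x * (\<Sum>b\<in>Basis. \<Sum>\<alpha>\<in>Rp. k \<alpha> * (b \<bullet> \<alpha>)\<^sup>2 / (x \<bullet> \<alpha>)\<^sup>2)"
    by (simp add: laplacian_def sum_subtractf sum_distrib_left)
  also have "(\<Sum>b\<in>Basis. (log_grad b x)\<^sup>2) = potential x"
    unfolding log_grad_def potential_def by (rule sum_Basis_log_gradient[OF nz])
  also have "(\<Sum>b\<in>Basis. \<Sum>\<alpha>\<in>Rp. k \<alpha> * (b \<bullet> \<alpha>)\<^sup>2 / (x \<bullet> \<alpha>)\<^sup>2) = (\<Sum>\<alpha>\<in>Rp. jump \<alpha> x)"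
  proof (subst sum.swap, rule sum.cong)
    fix \<alpha> :: 'a
    have "(norm \<alpha>)\<^sup>2 = (\<Sum>b\<in>Basis. (b \<bullet> \<alpha>)\<^sup>2)"
      unfolding power2_norm_eq_inner by (subst euclidean_inner) (simp add: power2_eq_square inner_commute)
    then show "(\<Sum>b\<in>Basis. k \<alpha> * (b \<bullet> \<alpha>)\<^sup>2 / (x \<bullet> \<alpha>)\<^sup>2) = jump \<alpha> x"
      by (simp add: jump_def sum_distrib_left sum_divide_distrib mult.commute)
  qed simp
  finally show ?thesis by (simp add: right_diff_distrib)
qed

text \<open>In the product rule for \<open>s\<close> \<phi>, the mixed gradient term supplies the
  first-order part of the Dunkl operator, and \<open>laplacian s - potential * s\<close> leaves the
  zeroth-order term with the total jump rate.\<close>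

lemma conjugated_laplacian:
  assumes x: "x \<in> U" and \<phi>: "C_k_on 2 UNIV \<phi>"
  shows "laplacian (\<lambda>y. s y * \<phi> y) x - potential x * (s x * \<phi> x) = s x * (laplacian \<phi> x
    + 2 * (\<Sum>\<alpha>\<in>Rp. k \<alpha> * (frechet_derivative \<phi> (at x) \<alpha> / (\<alpha> \<bullet> x))) - (\<Sum>\<alpha>\<in>Rp. jump \<alpha> x) * \<phi> x)"
proof -
  have "\<phi> differentiable (at x)" using \<phi> by (simp add: numeral_2_eq_2)
  note fd = frechet_derivative_eq_sum_Basis[OF this]
  have "(\<Sum>b\<in>Basis. frechet_derivative s (at x) b * frechet_derivative \<phi> (at x) b)
      = s x * (\<Sum>\<alpha>\<in>Rp. k \<alpha> * (frechet_derivative \<phi> (at x) \<alpha> / (\<alpha> \<bullet> x)))"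
  proof -
    have "(\<Sum>\<alpha>\<in>Rp. k \<alpha> * (frechet_derivative \<phi> (at x) \<alpha> / (\<alpha> \<bullet> x)))
      = (\<Sum>\<alpha>\<in>Rp. \<Sum>b\<in>Basis. k \<alpha> * (b \<bullet> \<alpha>) / (x \<bullet> \<alpha>) * frechet_derivative \<phi> (at x) b)"
      by (subst fd) (simp add: sum_distrib_left sum_divide_distrib inner_commute[of x] mult.assoc)
    also have "\<dots> = (\<Sum>b\<in>Basis. log_grad b x * frechet_derivative \<phi> (at x) b)"
      by (subst sum.swap) (simp add: log_grad_def sum_distrib_right)
    finally show ?thesis
      by (simp add: frechet_derivative_s[OF x] sum_distrib_left mult.assoc)
  qed
  then show ?thesis
    using laplacian_mult[OF open_U x C_k_on_s(1) C_k_on_subset[OF \<phi>]] laplacian_s[OF x]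
    by (simp add: algebra_simps)
qed

end

section \<open>The weak form of the Dunkl operator on test functions of \<open>D\<close>\<close>

context chamber
begin

lemma D_sets [measurable, simp]: "D \<in> sets borel"
  using open_D by simp

lemma test_function_extend_0:
  assumes "test_function D \<phi>" "x \<notin> D" shows "\<phi> x = 0" "frechet_derivative \<phi> (at x) = (\<lambda>h. 0)" "laplacian \<phi> x = 0"
  using test_function_eq_0[of x \<phi>] test_functionD(3)[OF assms(1)] assms(2) by blast+

text \<open>Together these make multiplication by \<open>s\<close> a bijection of the test functions
  of \<open>D\<close>, so both weak formulations test the same conditions.\<close>

lemma test_function_mult_s:
  assumes "test_function D \<phi>"
  shows "test_function D (\<lambda>x. s x * \<phi> x)" "test_function D (\<lambda>x. inverse (s x) * \<phi> x)"
  by (rule test_function_mult_smooth[OF assms open_U D_subset(2) C_k_on_s(1)],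
      rule test_function_mult_smooth[OF assms open_U D_subset(2) C_k_on_s(2)])

lemma set_integrable_mult_test:
  assumes \<psi>: "test_function D \<psi>" and u: "continuous_on D u"
  shows "set_integrable lborel D (\<lambda>x. u x * \<psi> x)"
    and "set_integrable lborel D (\<lambda>x. u x * laplacian \<psi> x)"
proof -
  define K where "K = closure {x. \<psi> x \<noteq> 0}"
  note K = test_functionD[OF \<psi>, folded K_def]
  have c: "continuous_on K u" "continuous_on K \<psi>" "continuous_on K (laplacian \<psi>)"
    using continuous_on_subset[OF u K(3)] continuous_on_subset[OF C_k_on_imp_continuous_on[OF K(1)]]
      continuous_on_subset[OF C_k_on_2_laplacian_continuous[OF K(1)]] by auto
  have o: "x \<notin> K \<Longrightarrow> \<psi> x = 0" "x \<notin> K \<Longrightarrow> laplacian \<psi> x = 0" for x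
    unfolding K_def using test_function_eq_0 by blast+
  have eq: "(\<lambda>x. indicator D x *\<^sub>R (u x * \<psi> x)) = (\<lambda>x. u x * \<psi> x)"
    "(\<lambda>x. indicator D x *\<^sub>R (u x * laplacian \<psi> x)) = (\<lambda>x. u x * laplacian \<psi> x)"
    using test_function_extend_0[OF \<psi>] by (auto simp: indicator_def intro!: ext)
  show "set_integrable lborel D (\<lambda>x. u x * \<psi> x)" "set_integrable lborel D (\<lambda>x. u x * laplacian \<psi> x)"
    unfolding set_integrable_def eq
    by (rule integrable_continuous_compact_support[OF K(2)], intro continuous_intros c, simp add: o)+
qed

text \<open>Only the values of \<open>q\<close> on \<open>D\<close> are known; replacing it by
  \<open>potential\<close> provides the continuity that integrability rests on.\<close>

lemma set_integrable_test_schrodinger: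
  assumes \<psi>: "test_function D \<psi>" and u: "continuous_on D u"
    and q: "\<And>x. x \<in> D \<Longrightarrow> q x = potential x"
  shows "set_integrable lborel D (\<lambda>x. u x * (laplacian \<psi> x - q x * \<psi> x))"
    and "(LINT x:D|lborel. u x * (laplacian \<psi> x - q x * \<psi> x))
      = (LINT x:D|lborel. u x * laplacian \<psi> x) - (LINT x:D|lborel. u x * potential x * \<psi> x)"
proof -
  have c: "continuous_on D (\<lambda>x. u x * potential x)"
    using u continuous_on_potential D_subset by (auto intro!: continuous_on_mult intro: continuous_on_subset)
  note i = set_integrable_mult_test(2)[OF \<psi> u] set_integrable_mult_test(1)[OF \<psi> c]
  have eq: "u x * (laplacian \<psi> x - q x * \<psi> x) = u x * laplacian \<psi> x - u x * potential x * \<psi> x" if "x \<in> D" for x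
    using q[OF that] by (simp add: algebra_simps)
  show "set_integrable lborel D (\<lambda>x. u x * (laplacian \<psi> x - q x * \<psi> x))"
    using set_integral_diff(1)[OF i] eq by (subst set_integrable_cong[OF refl refl eq]) auto
  show "(LINT x:D|lborel. u x * (laplacian \<psi> x - q x * \<psi> x))
      = (LINT x:D|lborel. u x * laplacian \<psi> x) - (LINT x:D|lborel. u x * potential x * \<psi> x)"
    unfolding set_integral_diff(2)[OF i, symmetric] by (rule set_lebesgue_integral_cong) (use eq in auto)
qed

lemma set_integral_laplacian_by_parts:
  assumes h: "C_k_on 2 D h" and \<psi>: "test_function D \<psi>"
  shows "(LINT x:D|lborel. h x * laplacian \<psi> x) = (LINT x:D|lborel. laplacian h x * \<psi> x)"
proof -
  have "(\<lambda>x. indicator D x *\<^sub>R (h x * laplacian \<psi> x)) = (\<lambda>x. h x * laplacian \<psi> x)"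
    "(\<lambda>x. indicator D x *\<^sub>R (laplacian h x * \<psi> x)) = (\<lambda>x. laplacian h x * \<psi> x)"
    using test_function_extend_0[OF \<psi>] by (auto simp: indicator_def intro!: ext)
  then show ?thesis
    using integral_laplacian_by_parts[OF h open_D \<psi>] by (simp add: set_lebesgue_integral_def)
qed

lemma continuous_on_source:
  assumes f: "continuous_on (- D) f"
  shows "continuous_on (closure D) (source f)"
proof -
  have "continuous_on (closure D) (\<lambda>x. f (reflection \<alpha> x))" if "\<alpha> \<in> Rp" for \<alpha>
    by (rule continuous_on_compose2[OF f]) (use reflection_notin_D that in \<open>auto intro!: continuous_intros\<close>)
  then show ?thesis
    unfolding source_def[abs_def]
    using continuous_on_s continuous_on_jump D_subset(3)
    by (auto intro!: continuous_on_mult continuous_on_sum intro: continuous_on_subset)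
qed

lemma source_cong:
  assumes "\<And>x. x \<notin> D \<Longrightarrow> f x = h x" "x \<in> closure D"
  shows "source f x = source h x"
  unfolding source_def using assms reflection_notin_D by auto

text \<open>The weight is split as \<open>s * s\<close>: one factor conjugates the local part, which
  is confined to \<open>D\<close>, and the other remains as a multiplier. The jumps are kept apart
  because they are seen from the reflected copies of \<open>D\<close>.\<close>

lemma dunkl_laplacian_test:
  assumes \<phi>: "test_function D \<phi>"
  shows "dunkl_laplacian Rp k \<phi> x * dunkl_weight Rp k x
    = indicator D x * (s x * (laplacian (\<lambda>y. s y * \<phi> y) x - potential x * (s x * \<phi> x)))
      + (\<Sum>\<alpha>\<in>Rp. jump \<alpha> x * \<phi> (reflection \<alpha> x) * dunkl_weight Rp k x)"
proof -
  define A where "A = laplacian \<phi> x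
      + 2 * (\<Sum>\<alpha>\<in>Rp. k \<alpha> * (frechet_derivative \<phi> (at x) \<alpha> / (\<alpha> \<bullet> x))) - (\<Sum>\<alpha>\<in>Rp. jump \<alpha> x) * \<phi> x"
  define S where "S = (\<Sum>\<alpha>\<in>Rp. jump \<alpha> x * \<phi> (reflection \<alpha> x))"
  have "dunkl_laplacian Rp k \<phi> x = A + S"
    unfolding dunkl_laplacian_def jump_def A_def S_def
    by (simp add: sum_distrib_left sum_distrib_right sum_subtractf[symmetric] sum.distrib[symmetric] inner_commute[of x])
      (intro sum.cong refl, simp add: algebra_simps diff_divide_distrib)
  \<comment> \<open>The conjugation formula is available only in the chamber; outside
    \<open>D\<close> both sides are zero because \<phi> and its derivatives vanish.\<close>
  moreover have "s x * A = indicator D x * (laplacian (\<lambda>y. s y * \<phi> y) x - potential x * (s x * \<phi> x))"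
  proof (cases "x \<in> D")
    case True
    then have "x \<in> U" using D_subset by auto
    then show ?thesis
      using conjugated_laplacian[OF _ test_functionD(1)[OF \<phi>], of x] True by (simp add: A_def)
  next
    case False
    then show ?thesis using test_function_extend_0[OF \<phi> False] by (simp add: A_def)
  qed
  ultimately have "dunkl_laplacian Rp k \<phi> x * (s x * s x)
    = s x * (indicator D x * (laplacian (\<lambda>y. s y * \<phi> y) x - potential x * (s x * \<phi> x))) + S * (s x * s x)"
    by (simp only: distrib_right) (metis mult.commute mult.left_commute)
  then show ?thesis by (simp only: s_square S_def sum_distrib_right mult.left_commute[of "indicator D x"])
qed

text \<open>Lebesgue measure, weight and jump rates are invariant under reflection. Substituting the
  mirror image therefore moves the reflection from \<phi> to \<open>h\<close> and brings the
  integral back to \<open>D\<close>, where it becomes \<open>source h\<close>.\<close>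

lemma integral_dunkl_laplacian:
  assumes h: "continuous_on UNIV h" and \<phi>: "test_function D \<phi>"
    and q: "\<And>x. x \<in> D \<Longrightarrow> q x = potential x"
  shows "(LINT x|lborel. h x * dunkl_laplacian Rp k \<phi> x * dunkl_weight Rp k x)
    = (LINT x:D|lborel. s x * h x * (laplacian (\<lambda>y. s y * \<phi> y) x - q x * (s x * \<phi> x)))
      + (LINT x:D|lborel. source h x * (s x * \<phi> x))"
proof -
  let ?\<psi> = "\<lambda>y. s y * \<phi> y"
  note \<psi> = test_function_mult_s(1)[OF \<phi>]
  have cs: "continuous_on D s" using continuous_on_s D_subset continuous_on_subset by blast
  have ch: "continuous_on D h" using h continuous_on_subset by blast
  define T where "T x = indicator D x *\<^sub>R (s x * h x * (laplacian ?\<psi> x - q x * ?\<psi> x))" for x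
  have iT: "integrable lborel T"
    using set_integrable_test_schrodinger(1)[OF \<psi> continuous_on_mult[OF cs ch] q]
    by (simp add: set_integrable_def T_def[abs_def])
  \<comment> \<open>One root's share of \<open>source h\<close> tested against \<open>s\<close>
    \<phi>. The term occurring in the Dunkl integrand is this function composed with the
    reflection.\<close>
  define S where "S \<alpha> y = indicator D y *\<^sub>R (s y * (jump \<alpha> y * h (reflection \<alpha> y)) * ?\<psi> y)" for \<alpha> y
  have iS: "integrable lborel (S \<alpha>)" if \<alpha>: "\<alpha> \<in> Rp" for \<alpha>
  proof -
    have "continuous_on D (\<lambda>y. s y * (jump \<alpha> y * h (reflection \<alpha> y)))"
      using continuous_on_jump[OF \<alpha>] D_subset cs continuous_on_compose2[OF h continuous_on_reflection[OF continuous_on_id]]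
      by (auto intro!: continuous_on_mult intro: continuous_on_subset)
    from set_integrable_mult_test(1)[OF \<psi> this] show ?thesis
      by (simp add: set_integrable_def S_def[abs_def])
  qed
  have "h x * dunkl_laplacian Rp k \<phi> x * dunkl_weight Rp k x = T x + (\<Sum>\<alpha>\<in>Rp. S \<alpha> (reflection \<alpha> x))" for x
  proof -
    have "S \<alpha> (reflection \<alpha> x) = h x * (jump \<alpha> x * \<phi> (reflection \<alpha> x) * dunkl_weight Rp k x)" if \<alpha>: "\<alpha> \<in> Rp" for \<alpha>
      using test_function_extend_0(1)[OF \<phi>, of "reflection \<alpha> x"]
      by (cases "reflection \<alpha> x \<in> D")
        (simp_all add: S_def jump_reflection[OF \<alpha>] s_reflection[OF \<alpha>] reflection_reflection[OF Rp_nonzero[OF \<alpha>]] s_square[symmetric] mult_ac)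
    moreover have "T x = h x * (indicator D x * (s x * (laplacian ?\<psi> x - potential x * ?\<psi> x)))"
      using q[of x] by (cases "x \<in> D") (simp_all add: T_def)
    ultimately show ?thesis
      unfolding mult.assoc dunkl_laplacian_test[OF \<phi>] by (simp add: distrib_left sum_distrib_left)
  qed
  then have "(LINT x|lborel. h x * dunkl_laplacian Rp k \<phi> x * dunkl_weight Rp k x)
      = (LINT x|lborel. T x) + (\<Sum>\<alpha>\<in>Rp. LINT x|lborel. S \<alpha> (reflection \<alpha> x))"
    using iT iS integrable_lborel_reflection[OF Rp_nonzero] by simp
  also have "(\<Sum>\<alpha>\<in>Rp. LINT x|lborel. S \<alpha> (reflection \<alpha> x)) = (LINT x|lborel. (\<Sum>\<alpha>\<in>Rp. S \<alpha> x))"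
    using iS integral_lborel_reflection[OF Rp_nonzero] by simp
  also have "(\<lambda>x. \<Sum>\<alpha>\<in>Rp. S \<alpha> x) = (\<lambda>x. indicator D x *\<^sub>R (source h x * ?\<psi> x))"
    by (auto simp: S_def source_def sum_distrib_left sum_distrib_right intro!: ext sum.cong)
  finally show ?thesis
    by (simp add: set_lebesgue_integral_def T_def)
qed

text \<open>As \<phi> runs through the test functions, so does \<open>s\<close> \<phi>; and in the
  source \<open>h\<close> may be replaced by \<open>f\<close>, since only values outside
  \<open>D\<close> enter.\<close>

lemma dunkl_dirichlet_solution_iff:
  assumes h: "continuous_on UNIV h" "\<And>x. x \<notin> D \<Longrightarrow> h x = f x"
    and q: "\<And>x. x \<in> D \<Longrightarrow> q x = potential x"
    and u: "\<And>x. x \<in> D \<Longrightarrow> u x = s x * h x"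
  shows "dunkl_dirichlet_solution Rp k D f h \<longleftrightarrow> (\<forall>\<psi>. test_function D \<psi> \<longrightarrow>
    (LINT x:D|lborel. u x * (laplacian \<psi> x - q x * \<psi> x)) = - (LINT x:D|lborel. source f x * \<psi> x))"
proof -
  have eq: "(LINT x:D|lborel. s x * h x * (laplacian \<psi> x - q x * \<psi> x)) = (LINT x:D|lborel. u x * (laplacian \<psi> x - q x * \<psi> x))"
    "(LINT x:D|lborel. source h x * \<psi> x) = (LINT x:D|lborel. source f x * \<psi> x)" for \<psi>
    by (rule set_lebesgue_integral_cong; use u source_cong[OF h(2)] D_subset(1) in auto)+
  have "dunkl_dirichlet_solution Rp k D f h \<longleftrightarrow> (\<forall>\<phi>. test_function D \<phi> \<longrightarrow>
     (LINT x:D|lborel. u x * (laplacian (\<lambda>y. s y * \<phi> y) x - q x * (s x * \<phi> x)))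
      + (LINT x:D|lborel. source f x * (s x * \<phi> x)) = 0)"
    using h integral_dunkl_laplacian[OF h(1) _ q]
    by (simp add: dunkl_dirichlet_solution_def eq)
  also have "\<dots> \<longleftrightarrow> (\<forall>\<psi>. test_function D \<psi> \<longrightarrow>
     (LINT x:D|lborel. u x * (laplacian \<psi> x - q x * \<psi> x)) + (LINT x:D|lborel. source f x * \<psi> x) = 0)" (is "?L \<longleftrightarrow> ?R")
  proof
    assume ?R then show ?L using test_function_mult_s(1) by blast
  next
    assume L: ?L
    show ?R
    proof (intro allI impI)
      fix \<psi> assume \<psi>: "test_function D \<psi>"
      \<comment> \<open>The cancellation holds even where \<open>s\<close> is zero, because such
        points lie outside \<open>D\<close> and \<psi> vanishes there.\<close>
      have "s x * (inverse (s x) * \<psi> x) = \<psi> x" for x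
        using test_function_extend_0(1)[OF \<psi>, of x] s_pos[of x] D_subset(2) by (cases "x \<in> D") auto
      then show "(LINT x:D|lborel. u x * (laplacian \<psi> x - q x * \<psi> x)) + (LINT x:D|lborel. source f x * \<psi> x) = 0"
        using L[rule_format, OF test_function_mult_s(2)[OF \<psi>]] by (simp only:)
    qed
  qed
  finally show ?thesis
    by (simp add: eq_neg_iff_add_eq_0)
qed

end

section \<open>Dirichlet problems\<close>

text \<open>Well-posedness enters twice: \<open>regular\<close> gives classical harmonic extensions,
  and \<open>green\<close> gives unique weak solutions with zero boundary values for bounded Borel
  data.\<close>

locale dunkl_dirichlet_problem = chamber +
  fixes q :: "'a \<Rightarrow> real" and G :: "'a \<Rightarrow> 'a \<Rightarrow> ennreal"
  assumes regular: "laplace_regular D"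
    and q: "\<And>x. x \<in> D \<Longrightarrow> q x = potential x"
    and green: "green_function D q G"
begin

lemma green_potential_solution:
  assumes g: "continuous_on (closure D) g"
  shows "green_potential_solution D q g (green_potential D q g)"
    and "x \<in> D \<Longrightarrow> green_potential D q g x = (LINT y:D|lborel. enn2real (G x y) * g y)"
proof -
  have "set_borel_measurable borel D g"
    using borel_measurable_continuous_on_indicator[OF D_sets continuous_on_subset[OF g D_subset(1)]]
    by (simp add: set_borel_measurable_def)
  moreover have "bounded (g ` D)"
    using compact_imp_bounded[OF compact_continuous_image[OF g compact_closure_D]]
    by (rule bounded_subset) (use D_subset(1) in auto)
  ultimately have "\<exists>!u. green_potential_solution D q g u"
    "x \<in> D \<Longrightarrow> green_potential D q g x = (LINT y:D|lborel. enn2real (G x y) * g y)"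
    using green unfolding green_function_def by auto
  then show "green_potential_solution D q g (green_potential D q g)"
    "x \<in> D \<Longrightarrow> green_potential D q g x = (LINT y:D|lborel. enn2real (G x y) * g y)"
    using theI'[of "green_potential_solution D q g"] by (auto simp: green_potential_def)
qed

text \<open>The difference, extended by zero, is a Green potential of the zero function, and so is
  zero itself; uniqueness of potentials is part of \<open>green\<close>.\<close>

lemma weak_solution_unique:
  assumes u: "continuous_on (closure D) u" "\<And>x. x \<in> frontier D \<Longrightarrow> u x = u' x"
    and u': "continuous_on (closure D) u'"
    and w: "\<And>\<psi>. test_function D \<psi> \<Longrightarrow> (LINT x:D|lborel. u x * (laplacian \<psi> x - q x * \<psi> x))
      = (LINT x:D|lborel. u' x * (laplacian \<psi> x - q x * \<psi> x))"
    and x: "x \<in> closure D"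
  shows "u x = u' x"
proof -
  define v where "v x = (if x \<in> closure D then u x - u' x else 0)" for x
  have cD: "continuous_on D u" "continuous_on D u'" using u u' D_subset(1) continuous_on_subset by auto
  have "green_potential_solution D q (\<lambda>_. 0) v"
    unfolding green_potential_solution_def
  proof (intro conjI allI impI ballI)
    show "continuous_on (closure D) v"
      using continuous_on_diff[OF u(1) u'] by (rule continuous_on_eq) (simp add: v_def)
    show "v x = 0" if "x \<notin> closure D" for x using that by (simp add: v_def)
    show "v x = 0" if "x \<in> frontier D" for x using that u by (simp add: v_def frontier_def)
    fix \<psi> assume \<psi>: "test_function D \<psi>"
    note i = set_integrable_test_schrodinger(1)[OF \<psi> cD(1) q] set_integrable_test_schrodinger(1)[OF \<psi> cD(2) q]
    have "(LINT x:D|lborel. v x * (laplacian \<psi> x - q x * \<psi> x))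
      = (LINT x:D|lborel. u x * (laplacian \<psi> x - q x * \<psi> x) - u' x * (laplacian \<psi> x - q x * \<psi> x))"
      using D_subset(1) by (intro set_lebesgue_integral_cong) (auto simp: v_def left_diff_distrib)
    then show "(LINT x:D|lborel. v x * (laplacian \<psi> x - q x * \<psi> x)) = - (LINT x:D|lborel. 0 * \<psi> x)"
      using set_integral_diff(2)[OF i] w[OF \<psi>] by (simp add: set_lebesgue_integral_def)
  qed
  moreover have "green_potential_solution D q (\<lambda>_. 0) (\<lambda>_. 0)"
    by (simp add: green_potential_solution_def set_lebesgue_integral_def)
  moreover have "\<exists>!u. green_potential_solution D q (\<lambda>_. 0) u"
    using green by (auto simp: green_function_def set_borel_measurable_def image_constant_conv)
  ultimately have "v = (\<lambda>_. 0)" by auto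
  then show ?thesis using x by (auto simp: v_def fun_eq_iff split: if_splits)
qed

text \<open>The solution is the harmonic extension \<open>h\<close> of \<open>g\<close> minus the Green potential of \<open>q h\<close>.\<close>

lemma schrodinger_dirichlet_solution:
  assumes g: "continuous_on (frontier D) g"
  shows "schrodinger_dirichlet_solution D q g (schrodinger_dirichlet D q g)"
proof -
  from ex1_implies_ex[OF regular[unfolded laplace_regular_def harmonic_on_def, rule_format, OF g]]
  obtain h where "continuous_on (closure D) h \<and> (\<forall>x. x \<notin> closure D \<longrightarrow> h x = 0) \<and>
      (\<forall>x\<in>frontier D. h x = g x) \<and> C_k_on 2 D h \<and> (\<forall>x\<in>D. laplacian h x = 0)" ..
  then have h: "continuous_on (closure D) h" "\<And>x. x \<notin> closure D \<Longrightarrow> h x = 0"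
      "\<And>x. x \<in> frontier D \<Longrightarrow> h x = g x" "C_k_on 2 D h" "\<And>x. x \<in> D \<Longrightarrow> laplacian h x = 0"
    by simp_all
  \<comment> \<open>Weakly \<open>(\<Delta> - q) h\<close> equals \<open>p\<close> and the Green
    potential of \<open>p\<close> satisfies the equation with \<open>- p\<close>. Writing
    \<open>potential\<close> instead of \<open>q\<close> makes \<open>p\<close> continuous up to the
    boundary, where \<open>q\<close> is not specified.\<close>
  define p where "p x = - (potential x * h x)" for x
  have cp: "continuous_on (closure D) p"
    unfolding p_def[abs_def] using continuous_on_potential D_subset(3) h(1)
    by (auto intro!: continuous_on_minus continuous_on_mult intro: continuous_on_subset)
  define w where "w = green_potential D q p"
  note gw = green_potential_solution(1)[OF cp, folded w_def, unfolded green_potential_solution_def]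
  then have w: "continuous_on (closure D) w" "\<And>x. x \<notin> closure D \<Longrightarrow> w x = 0" "\<And>x. x \<in> frontier D \<Longrightarrow> w x = 0"
    "\<And>\<psi>. test_function D \<psi> \<Longrightarrow> (LINT x:D|lborel. w x * (laplacian \<psi> x - q x * \<psi> x)) = - (LINT x:D|lborel. p x * \<psi> x)"
    by auto
  have cD: "continuous_on D h" "continuous_on D w" using h w D_subset(1) continuous_on_subset by auto
  have sol: "schrodinger_dirichlet_solution D q g (\<lambda>x. h x + w x)"
    unfolding schrodinger_dirichlet_solution_def
  proof (intro conjI allI impI ballI)
    show "continuous_on (closure D) (\<lambda>x. h x + w x)" using h(1) w(1) by (rule continuous_on_add)
    fix \<psi> assume \<psi>: "test_function D \<psi>"
    note i = set_integrable_test_schrodinger(1)[OF \<psi> cD(1) q] set_integrable_test_schrodinger(1)[OF \<psi> cD(2) q]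
    have "(LINT x:D|lborel. h x * laplacian \<psi> x) = 0"
      unfolding set_integral_laplacian_by_parts[OF h(4) \<psi>] unfolding set_lebesgue_integral_def
      by (rule integral_eq_zero_AE) (use h(5) in \<open>auto simp: indicator_def\<close>)
    then have "(LINT x:D|lborel. h x * (laplacian \<psi> x - q x * \<psi> x)) = (LINT x:D|lborel. p x * \<psi> x)"
      using set_integrable_test_schrodinger(2)[OF \<psi> cD(1) q]
      by (simp add: p_def mult.commute[of "h _"] set_lebesgue_integral_def)
    then show "(LINT x:D|lborel. (h x + w x) * (laplacian \<psi> x - q x * \<psi> x)) = 0"
      using set_integral_add(2)[OF i] w(4)[OF \<psi>] by (simp add: distrib_right)
  qed (use h w in auto)
  have "u = (\<lambda>x. h x + w x)" if u: "schrodinger_dirichlet_solution D q g u" for u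
  proof
    fix x
    show "u x = h x + w x"
    proof (cases "x \<in> closure D")
      case True
      show ?thesis
        by (rule weak_solution_unique[OF _ _ _ _ True])
          (use u sol in \<open>auto simp: schrodinger_dirichlet_solution_def\<close>)
    next
      case False
      then show ?thesis using u sol by (auto simp: schrodinger_dirichlet_solution_def)
    qed
  qed
  with sol have "\<exists>!u. schrodinger_dirichlet_solution D q g u" by (rule ex1I)
  then show ?thesis
    unfolding schrodinger_dirichlet_def by (rule theI')
qed

text \<open>Two solutions multiplied by \<open>s\<close> satisfy the same weak equation with the
  same boundary values, and \<open>s\<close> can be cancelled in \<open>D\<close>.\<close>

lemma dunkl_dirichlet_eq:
  assumes h: "dunkl_dirichlet_solution Rp k D f h"
  shows "dunkl_dirichlet Rp k D f = h"
  unfolding dunkl_dirichlet_def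
proof (rule the_equality[where P="dunkl_dirichlet_solution Rp k D f", OF h])
  fix h' assume h': "dunkl_dirichlet_solution Rp k D f h'"
  have c: "continuous_on UNIV h" "continuous_on UNIV h'" "x \<notin> D \<Longrightarrow> h x = f x" "x \<notin> D \<Longrightarrow> h' x = f x" for x
    using h h' by (auto simp: dunkl_dirichlet_solution_def)
  have cs: "continuous_on (closure D) s" using continuous_on_s D_subset continuous_on_subset by blast
  have "h' x = h x" if x: "x \<in> D" for x
  proof -
    have "s x * h' x = s x * h x"
    proof (rule weak_solution_unique)
      show "continuous_on (closure D) (\<lambda>x. s x * h' x)" "continuous_on (closure D) (\<lambda>x. s x * h x)"
        using cs c(1,2) by (auto intro!: continuous_on_mult intro: continuous_on_subset)
      show "s x * h' x = s x * h x" if "x \<in> frontier D" for x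
        using that c open_D by (simp add: frontier_def interior_open)
      show "x \<in> closure D" using x D_subset by auto
      show "(LINT x:D|lborel. s x * h' x * (laplacian \<psi> x - q x * \<psi> x)) = (LINT x:D|lborel. s x * h x * (laplacian \<psi> x - q x * \<psi> x))"
        if "test_function D \<psi>" for \<psi>
        using that h h' dunkl_dirichlet_solution_iff[OF c(1,3) q, of "\<lambda>x. s x * h x"]
          dunkl_dirichlet_solution_iff[OF c(2,4) q, of "\<lambda>x. s x * h' x"] by simp
    qed
    then show ?thesis using s_pos[of x] x D_subset by auto
  qed
  then show "h' = h" using c by (metis ext)
qed

lemma dunkl_dirichlet_formula:
  assumes f: "continuous_on (- D) f" and x: "x \<in> D"
  shows "dunkl_dirichlet Rp k D f x
    = (schrodinger_dirichlet D q (\<lambda>y. s y * f y) x + green_potential D q (source f) x) / s x"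
proof -
  have fD: "frontier D \<subseteq> - D" using open_D by (auto simp: frontier_def interior_open)
  have cs: "continuous_on (closure D) s" using continuous_on_s D_subset continuous_on_subset by blast
  have "continuous_on (frontier D) (\<lambda>y. s y * f y)"
    using continuous_on_s D_subset(4) f fD continuous_on_subset by (blast intro: continuous_on_mult)
  define u1 where "u1 = schrodinger_dirichlet D q (\<lambda>y. s y * f y)"
  define u2 where "u2 = green_potential D q (source f)"
  have "schrodinger_dirichlet_solution D q (\<lambda>y. s y * f y) u1"
    unfolding u1_def by (rule schrodinger_dirichlet_solution) fact
  then have u1: "continuous_on (closure D) u1" "\<And>x. x \<in> frontier D \<Longrightarrow> u1 x = s x * f x"
    "\<And>\<psi>. test_function D \<psi> \<Longrightarrow> (LINT x:D|lborel. u1 x * (laplacian \<psi> x - q x * \<psi> x)) = 0"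
    by (auto simp: schrodinger_dirichlet_solution_def)
  have "green_potential_solution D q (source f) u2"
    unfolding u2_def by (rule green_potential_solution(1)[OF continuous_on_source[OF f]])
  then have u2: "continuous_on (closure D) u2" "\<And>x. x \<in> frontier D \<Longrightarrow> u2 x = 0"
    "\<And>\<psi>. test_function D \<psi> \<Longrightarrow> (LINT x:D|lborel. u2 x * (laplacian \<psi> x - q x * \<psi> x)) = - (LINT x:D|lborel. source f x * \<psi> x)"
    by (auto simp: green_potential_solution_def)
  define h where "h x = (if x \<in> closure D then (u1 x + u2 x) / s x else f x)" for x
  have s0: "s x \<noteq> 0" if "x \<in> closure D" for x using s_pos[of x] that D_subset by auto
  \<comment> \<open>On the frontier \<open>u1\<close> is \<open>s f\<close> and \<open>u2\<close> is
    zero, so the two branches agree there and glue along the closed sets \<open>closure D\<close>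
    and \<open>- D\<close>.\<close>
  have hf: "h x = f x" if "x \<notin> D" for x
    using that u1 u2 s0[of x] open_D by (auto simp: h_def frontier_def interior_open)
  have "continuous_on (closure D) h"
    by (rule continuous_on_eq[where f="\<lambda>x. (u1 x + u2 x) / s x"])
      (use u1 u2 cs s0 in \<open>auto intro!: continuous_intros simp: h_def\<close>)
  moreover have "continuous_on (- D) h"
    using f by (rule continuous_on_eq) (simp add: hf)
  ultimately have "continuous_on (closure D \<union> - D) h"
    using open_D by (intro continuous_on_closed_Un) auto
  moreover have "closure D \<union> - D = UNIV" using D_subset by auto
  ultimately have ch: "continuous_on UNIV h" by simp
  have cD: "continuous_on D u1" "continuous_on D u2" using u1 u2 D_subset(1) continuous_on_subset by auto
  have "dunkl_dirichlet_solution Rp k D f h"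
  proof (subst dunkl_dirichlet_solution_iff[OF ch hf q])
    show "u1 x + u2 x = s x * h x" if "x \<in> D" for x
      using that s0[of x] D_subset(1) by (auto simp: h_def)
    show "\<forall>\<psi>. test_function D \<psi> \<longrightarrow> (LINT x:D|lborel. (u1 x + u2 x) * (laplacian \<psi> x - q x * \<psi> x)) = - (LINT x:D|lborel. source f x * \<psi> x)"
    proof (intro allI impI)
      fix \<psi> assume \<psi>: "test_function D \<psi>"
      note i = set_integrable_test_schrodinger(1)[OF \<psi> cD(1) q] set_integrable_test_schrodinger(1)[OF \<psi> cD(2) q]
      show "(LINT x:D|lborel. (u1 x + u2 x) * (laplacian \<psi> x - q x * \<psi> x)) = - (LINT x:D|lborel. source f x * \<psi> x)"
        using set_integral_add(2)[OF i] u1(3)[OF \<psi>] u2(3)[OF \<psi>] by (simp add: distrib_right)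
    qed
  qed
  from dunkl_dirichlet_eq[OF this] show ?thesis
    using x D_subset(1) by (auto simp: h_def u1_def u2_def)
qed

text \<open>Here \<open>s\<close> itself is the conjugated solution: by \<open>laplacian_s\<close>,
  what remains of its Laplacian after subtracting \<open>potential * s\<close> is exactly minus the
  source of the constant 1.\<close>

lemma dunkl_dirichlet_const: "dunkl_dirichlet Rp k D (\<lambda>_. 1) = (\<lambda>_. 1)"
proof (rule dunkl_dirichlet_eq, subst dunkl_dirichlet_solution_iff[OF _ _ q])
  have cs: "continuous_on D s" "C_k_on 2 D s" using continuous_on_s C_k_on_s(1)[of 2] D_subset(2)
    by (auto intro: continuous_on_subset C_k_on_subset)
  show "\<forall>\<psi>. test_function D \<psi> \<longrightarrow> (LINT x:D|lborel. s x * (laplacian \<psi> x - q x * \<psi> x)) = - (LINT x:D|lborel. source (\<lambda>_. 1) x * \<psi> x)"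
  proof (intro allI impI)
    fix \<psi> assume \<psi>: "test_function D \<psi>"
    have c: "continuous_on D (source (\<lambda>_. 1))" "continuous_on D (\<lambda>x. s x * potential x)"
      using continuous_on_source[of "\<lambda>_. 1"] cs continuous_on_potential D_subset
      by (auto intro!: continuous_on_mult intro: continuous_on_subset)
    note i = set_integrable_mult_test(1)[OF \<psi> c(2)] set_integrable_mult_test(1)[OF \<psi> c(1)]
    have "(LINT x:D|lborel. laplacian s x * \<psi> x) = (LINT x:D|lborel. s x * potential x * \<psi> x - source (\<lambda>_. 1) x * \<psi> x)"
    proof (intro set_lebesgue_integral_cong allI impI)
      fix x assume "x \<in> D"
      then have "x \<in> U" using D_subset(2) by blast
      then show "laplacian s x * \<psi> x = s x * potential x * \<psi> x - source (\<lambda>_. 1) x * \<psi> x"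
        by (simp add: laplacian_s source_def left_diff_distrib right_diff_distrib)
    qed simp
    also have "\<dots> = (LINT x:D|lborel. s x * potential x * \<psi> x) - (LINT x:D|lborel. source (\<lambda>_. 1) x * \<psi> x)"
      by (rule set_integral_diff(2)[OF i])
    finally show "(LINT x:D|lborel. s x * (laplacian \<psi> x - q x * \<psi> x)) = - (LINT x:D|lborel. source (\<lambda>_. 1) x * \<psi> x)"
      using set_integrable_test_schrodinger(2)[OF \<psi> cs(1) q] set_integral_laplacian_by_parts[OF cs(2) \<psi>] by simp
  qed
qed auto

end

section \<open>The harmonic measure\<close>

context dunkl_dirichlet_problem
begin

lemma continuous_on_s_closure: "continuous_on (closure D) s"
  using continuous_on_s D_subset continuous_on_subset by blast

lemma bounded_on_closure_D:
  fixes g :: "'a \<Rightarrow> real"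
  assumes "continuous_on (closure D) g"
  obtains B where "0 \<le> B" "\<And>x. x \<in> D \<Longrightarrow> \<bar>g x\<bar> \<le> B"
proof -
  obtain B where "0 < B" "\<And>y. y \<in> g ` closure D \<Longrightarrow> norm y \<le> B"
    using compact_imp_bounded[OF compact_continuous_image[OF assms compact_closure_D]] by (auto simp: bounded_pos)
  then show ?thesis using that[of B] D_subset(1) by (auto simp: less_imp_le)
qed

lemma continuous_on_frontier_D: "continuous_on (- D) f \<Longrightarrow> continuous_on (frontier D) (\<lambda>y. s y * f y)"
proof (rule continuous_on_mult)
  show "continuous_on (frontier D) s"
    using continuous_on_s D_subset(4) continuous_on_subset by blast
  have "frontier D \<subseteq> - D" using open_D by (auto simp: frontier_def interior_open)
  then show "continuous_on (- D) f \<Longrightarrow> continuous_on (frontier D) f"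
    using continuous_on_subset by blast
qed

definition carrier_set :: "'a set" where
  "carrier_set = frontier D \<union> (\<Union>\<alpha>\<in>Rp. reflection \<alpha> ` D)"

lemma reflection_image_D: "\<alpha> \<in> Rp \<Longrightarrow> reflection \<alpha> ` D = {y. reflection \<alpha> y \<in> D}"
proof (intro set_eqI iffI)
  fix y assume \<alpha>: "\<alpha> \<in> Rp"
  note r = reflection_reflection[OF Rp_nonzero[OF \<alpha>]]
  show "y \<in> {y. reflection \<alpha> y \<in> D}" if "y \<in> reflection \<alpha> ` D" using that by (auto simp: r)
  show "y \<in> reflection \<alpha> ` D" if "y \<in> {y. reflection \<alpha> y \<in> D}"
    using that by (intro image_eqI[of _ _ "reflection \<alpha> y"]) (simp_all add: r)
qed

lemma carrier_set_eq: "carrier_set = frontier D \<union> (\<Union>\<alpha>\<in>Rp. {y. reflection \<alpha> y \<in> D})"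
  by (simp add: carrier_set_def reflection_image_D)

lemma carrier_set_sets [measurable, simp]: "carrier_set \<in> sets borel"
proof -
  have "{y. reflection \<alpha> y \<in> D} \<in> sets borel" for \<alpha>
    using measurable_sets_borel[OF borel_measurable_reflection D_sets, of \<alpha>] by (simp add: vimage_def)
  then show ?thesis
    unfolding carrier_set_eq by (intro sets.Un sets.finite_UN finite_Rp) auto
qed

lemma carrier_setE:
  assumes "y \<in> carrier_set"
  obtains "y \<in> frontier D" | \<alpha> where "\<alpha> \<in> Rp" "reflection \<alpha> y \<in> D"
  using assms unfolding carrier_set_eq by blast

lemma carrier_set_disjoint: "y \<in> carrier_set \<Longrightarrow> y \<notin> D"
proof (elim carrier_setE)
  show "y \<notin> D" if "y \<in> frontier D"
    using that open_D by (simp add: frontier_def interior_open)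
  show "y \<notin> D" if "\<alpha> \<in> Rp" "reflection \<alpha> y \<in> D" for \<alpha>
    using that reflection_notin_D D_subset(1) by blast
qed

text \<open>Elsewhere in the complement of \<open>D\<close> the weight may vanish. Positivity on
  this set, by invariance of \<open>s\<close> on the reflected copies, is what permits division by
  \<open>s\<close> in the measure identity.\<close>

lemma s_pos_carrier_set: "y \<in> carrier_set \<Longrightarrow> 0 < s y"
proof (elim carrier_setE)
  show "0 < s y" if "y \<in> frontier D"
    using that D_subset(4) by (blast intro: s_pos)
  show "0 < s y" if "\<alpha> \<in> Rp" "reflection \<alpha> y \<in> D" for \<alpha>
    using s_pos[of "reflection \<alpha> y"] s_reflection[OF that(1), of y] that(2) D_subset(2) by auto
qed

section \<open>The candidate measure for a fixed point of \<open>D\<close>\<close>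

context
  fixes x Hq
  assumes x: "x \<in> D" and Hq: "schrodinger_harmonic_measure D q x Hq"
begin

definition green_real :: "'a \<Rightarrow> real" where "green_real y = enn2real (G x y)"

definition jump_density :: "'a \<Rightarrow> real" where
  "jump_density y = (\<Sum>\<alpha>\<in>Rp. jump \<alpha> y * green_real (reflection \<alpha> y))"

text \<open>The right-hand side of the claimed identity, with the real version of the Green
  function. Dividing out the factor \<open>s x / s y\<close> then gives the candidate
  \<open>solution_measure\<close>.\<close>

definition weighted_measure :: "'a measure" where
  "weighted_measure = plus_measure Hq (density lborel (\<lambda>y. ennreal (jump_density y)))"

definition solution_measure :: "'a measure" where
  "solution_measure = density weighted_measure (\<lambda>y. ennreal (s y / s x))"

lemma G_measurable [measurable]: "G x \<in> borel_measurable borel"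
  and G_outside: "y \<notin> D \<Longrightarrow> G x y = 0"
  and G_integral: "(\<integral>\<^sup>+y. G x y \<partial>lborel) < \<infinity>"
  using green x by (auto simp: green_function_def)

lemma green_real_measurable [measurable]: "green_real \<in> borel_measurable borel"
  unfolding green_real_def[abs_def] by measurable

lemma green_real_nonneg: "0 \<le> green_real y"
  by (simp add: green_real_def)

lemma green_real_outside: "y \<notin> D \<Longrightarrow> green_real y = 0"
  by (simp add: green_real_def G_outside)

text \<open>A function with finite integral is finite almost everywhere, so the passage to real
  values, needed for signed integrands, loses only a null set.\<close>

lemma AE_green_real: "AE y in lborel. G x y = ennreal (green_real y)"
proof -
  have "AE y in lborel. G x y \<noteq> \<infinity>"
    using G_integral by (intro nn_integral_noteq_infinite) auto
  then show ?thesis by eventually_elim (simp add: green_real_def less_top)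
qed

lemma integrable_green_real: "integrable lborel green_real"
proof (rule integrableI_nonneg)
  have "(\<integral>\<^sup>+y. ennreal (green_real y) \<partial>lborel) = (\<integral>\<^sup>+y. G x y \<partial>lborel)"
    using AE_green_real by (intro nn_integral_cong_AE) auto
  then show "(\<integral>\<^sup>+y. ennreal (green_real y) \<partial>lborel) < \<infinity>" using G_integral by simp
qed (simp_all add: green_real_nonneg)

text \<open>The exceptional null set stays null under reflection, since Lebesgue measure is
  invariant.\<close>

lemma AE_reflected_green:
  assumes \<alpha>: "\<alpha> \<in> Rp"
  shows "AE y in lborel. G x (reflection \<alpha> y) = ennreal (green_real (reflection \<alpha> y))"
proof -
  have d: "distr lborel borel (reflection \<alpha>) = lborel"
    by (rule lborel_distr_orthogonal[OF orthogonal_transformation_reflection[OF Rp_nonzero[OF \<alpha>]]])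
  have "AE y in distr lborel borel (reflection \<alpha>). G x y = ennreal (green_real y)"
    unfolding d by (rule AE_green_real)
  then show ?thesis by (subst (asm) AE_distr_iff) simp_all
qed

lemma jump_density_measurable [measurable]: "jump_density \<in> borel_measurable borel"
  unfolding jump_density_def[abs_def] by measurable

lemma jump_density_nonneg: "0 \<le> jump_density y"
  unfolding jump_density_def by (intro sum_nonneg mult_nonneg_nonneg jump_nonneg green_real_nonneg)

lemma sets_Hq [simp, measurable_cong]: "sets Hq = sets borel"
  and Hq_frontier: "emeasure Hq (- frontier D) = 0"
  and Hq_represents: "represents_on (frontier D) Hq (\<lambda>g. schrodinger_dirichlet D q g x)"
  using Hq by (auto simp: schrodinger_harmonic_measure_def radon_measure_on_def)

lemma space_Hq [simp]: "space Hq = UNIV"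
  using sets_eq_imp_space_eq[OF sets_Hq] by simp

lemma sets_weighted_measure [simp, measurable_cong]: "sets weighted_measure = sets borel"
  and space_weighted_measure [simp]: "space weighted_measure = UNIV"
  by (auto simp: weighted_measure_def)

lemma sets_solution_measure [simp, measurable_cong]: "sets solution_measure = sets borel"
  and space_solution_measure [simp]: "space solution_measure = UNIV"
  by (auto simp: solution_measure_def)

text \<open>\<open>Hq\<close> lives on the frontier, and the density vanishes off the reflected
  copies of \<open>D\<close> because the Green function vanishes outside \<open>D\<close>.\<close>

lemma weighted_measure_carrier: "emeasure weighted_measure (- carrier_set) = 0"
proof -
  have C: "- carrier_set \<in> sets borel" by auto
  have "emeasure Hq (- carrier_set) \<le> emeasure Hq (- frontier D)"
    by (rule emeasure_mono) (auto simp: carrier_set_def)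
  then have "emeasure Hq (- carrier_set) = 0" by (simp add: Hq_frontier)
  moreover have 0: "jump_density y = 0" if "y \<notin> carrier_set" for y
    unfolding jump_density_def using that by (intro sum.neutral) (auto simp: carrier_set_eq green_real_outside)
  then have "emeasure (density lborel (\<lambda>y. ennreal (jump_density y))) (- carrier_set) = 0"
  proof (subst emeasure_density)
    have "ennreal (jump_density y) * indicator (- carrier_set) y = 0" for y
      using 0[of y] by (cases "y \<in> carrier_set") simp_all
    then show "(\<integral>\<^sup>+y. ennreal (jump_density y) * indicator (- carrier_set) y \<partial>lborel) = 0" by (simp only: nn_integral_const mult_zero_left)
  qed (use C in simp_all)
  ultimately show ?thesis
    using C by (simp add: weighted_measure_def emeasure_plus_measure)
qed

lemma AE_weighted_measure: "AE y in weighted_measure. y \<in> carrier_set"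
  by (rule AE_I[of _ _ "- carrier_set"]) (auto simp: weighted_measure_carrier)

lemma solution_measure_carrier: "emeasure solution_measure (- carrier_set) = 0"
proof -
  have "- carrier_set \<in> null_sets weighted_measure"
    by (simp add: null_sets_def weighted_measure_carrier)
  then have "- carrier_set \<in> null_sets solution_measure"
    using absolutely_continuousI_density[of "\<lambda>y. ennreal (s y / s x)" weighted_measure]
    by (auto simp: solution_measure_def absolutely_continuous_def)
  then show ?thesis by auto
qed

lemma solution_measure_D: "emeasure solution_measure D = 0"
proof -
  have "emeasure solution_measure D \<le> emeasure solution_measure (- carrier_set)"
    by (rule emeasure_mono) (auto dest: carrier_set_disjoint)
  then show ?thesis by (simp add: solution_measure_carrier)
qed

text \<open>Substituting the mirror image turns each summand into an integral over \<open>D\<close>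
  against the Green function, and the sum into the potential of \<open>source f\<close>. An
  unbounded \<open>f\<close> does no harm: it is evaluated only on reflections of the compact set
  \<open>closure D\<close>.\<close>

lemma
  assumes f: "continuous_on (- D) f"
  shows integrable_jump_part: "integrable lborel (\<lambda>y. jump_density y * (s y / s x * (indicator (- D) y * f y)))" (is "integrable lborel ?F")
    and integral_jump_part: "(LINT y|lborel. jump_density y * (s y / s x * (indicator (- D) y * f y)))
      = green_potential D q (source f) x / s x"
proof -
  define H where "H \<alpha> z = green_real z * (indicator D z * (jump \<alpha> z * s z * f (reflection \<alpha> z) / s x))" for \<alpha> z
  have iH: "integrable lborel (H \<alpha>)" if \<alpha>: "\<alpha> \<in> Rp" for \<alpha>
  proof -
    have c: "continuous_on (closure D) (\<lambda>z. jump \<alpha> z * s z * f (reflection \<alpha> z) / s x)"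
      unfolding divide_inverse
      using continuous_on_subset[OF continuous_on_jump[OF \<alpha>] D_subset(3)] continuous_on_s_closure
      by (intro continuous_on_mult continuous_on_const continuous_on_compose2[OF f])
        (use reflection_notin_D \<alpha> in \<open>auto intro!: continuous_intros\<close>)
    obtain B where B: "0 \<le> B" "\<And>z. z \<in> D \<Longrightarrow> \<bar>jump \<alpha> z * s z * f (reflection \<alpha> z) / s x\<bar> \<le> B"
      using bounded_on_closure_D[OF c] by blast
    have [measurable]: "(\<lambda>z. indicator D z * (jump \<alpha> z * s z * f (reflection \<alpha> z) / s x)) \<in> borel_measurable borel"
      using borel_measurable_continuous_on_indicator[OF D_sets continuous_on_subset[OF c D_subset(1)]] by simp
    show ?thesis
    proof (rule Bochner_Integration.integrable_bound)
      show "integrable lborel (\<lambda>z. B * green_real z)" using integrable_green_real by simp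
      show "H \<alpha> \<in> borel_measurable lborel" unfolding H_def[abs_def] by measurable
      have "\<bar>H \<alpha> z\<bar> \<le> B * green_real z" for z
      proof (cases "z \<in> D")
        case True
        have "\<bar>H \<alpha> z\<bar> = green_real z * \<bar>jump \<alpha> z * s z * f (reflection \<alpha> z) / s x\<bar>"
          using True by (simp add: H_def abs_mult green_real_nonneg)
        also have "\<dots> \<le> green_real z * B"
          by (rule mult_left_mono[OF B(2)[OF True] green_real_nonneg])
        finally show ?thesis by (simp add: mult.commute)
      qed (simp add: H_def B(1) green_real_nonneg)
      then show "AE z in lborel. norm (H \<alpha> z) \<le> norm (B * green_real z)"
        by (intro AE_I2) (simp add: order_trans[OF _ abs_ge_self])
    qed
  qed
  have eq: "?F y = (\<Sum>\<alpha>\<in>Rp. H \<alpha> (reflection \<alpha> y))" for y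
    unfolding jump_density_def sum_distrib_right
  proof (rule sum.cong)
    fix \<alpha> assume \<alpha>: "\<alpha> \<in> Rp"
    show "jump \<alpha> y * green_real (reflection \<alpha> y) * (s y / s x * (indicator (- D) y * f y)) = H \<alpha> (reflection \<alpha> y)"
    proof (cases "reflection \<alpha> y \<in> D")
      case True
      then have "y \<notin> D"
        using carrier_set_disjoint[of y] \<alpha> by (auto simp: carrier_set_eq)
      then show ?thesis using True
        by (simp add: H_def jump_reflection[OF \<alpha>] s_reflection[OF \<alpha>] reflection_reflection[OF Rp_nonzero[OF \<alpha>]])
    next
      case False
      then show ?thesis by (simp add: H_def green_real_outside)
    qed
  qed simp
  show "integrable lborel ?F"
    unfolding eq using iH integrable_lborel_reflection[OF Rp_nonzero] by simp
  have "(LINT y|lborel. ?F y) = (LINT z|lborel. (\<Sum>\<alpha>\<in>Rp. H \<alpha> z))"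
    unfolding eq using iH integral_lborel_reflection[OF Rp_nonzero] integrable_lborel_reflection[OF Rp_nonzero] by simp
  also have "(\<lambda>z. \<Sum>\<alpha>\<in>Rp. H \<alpha> z) = (\<lambda>z. indicator D z *\<^sub>R (green_real z * source f z) / s x)"
    by (simp add: H_def source_def sum_distrib_left sum_divide_distrib mult_ac)
  also have "(LINT z|lborel. indicator D z *\<^sub>R (green_real z * source f z) / s x) = green_potential D q (source f) x / s x"
    using green_potential_solution(2)[OF continuous_on_source[OF f] x]
    by (simp add: set_lebesgue_integral_def green_real_def)
  finally show "(LINT y|lborel. ?F y) = green_potential D q (source f) x / s x" .
qed

lemma represents_solution_measure:
  "represents_on (- D) solution_measure (\<lambda>f. dunkl_dirichlet Rp k D f x)"
  unfolding represents_on_def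
proof (intro allI impI)
  fix f :: "'a \<Rightarrow> real" assume f: "continuous_on (- D) f"
  have [measurable]: "(\<lambda>y. indicator (- D) y * f y) \<in> borel_measurable borel"
    using borel_measurable_continuous_on_indicator[OF _ f] by simp
  \<comment> \<open>The values of \<open>f\<close> inside \<open>D\<close> are arbitrary, so they
    are cut off to obtain a Borel function on the whole space.\<close>
  define F where "F y = s y / s x * (indicator (- D) y * f y)" for y
  have [measurable]: "F \<in> borel_measurable borel" unfolding F_def[abs_def] by measurable
  \<comment> \<open>\<open>Hq\<close> does not charge the complement of the frontier, so the cut-off
    can be exchanged for the one appearing in \<open>represents_on\<close>.\<close>
  have AE: "AE y in Hq. F y = (indicator (frontier D) y *\<^sub>R (s y * f y)) / s x"
  proof (rule AE_I[of _ _ "- frontier D"])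
    show "{y \<in> space Hq. F y \<noteq> indicator (frontier D) y *\<^sub>R (s y * f y) / s x} \<subseteq> - frontier D"
      using open_D by (auto simp: F_def frontier_def interior_open)
  qed (auto simp: Hq_frontier)
  have r: "set_integrable Hq (frontier D) (\<lambda>y. s y * f y)"
    "(LINT y:frontier D|Hq. s y * f y) = schrodinger_dirichlet D q (\<lambda>y. s y * f y) x"
    using Hq_represents continuous_on_frontier_D[OF f] by (auto simp: represents_on_def)
  have m: "(\<lambda>y. indicator (frontier D) y *\<^sub>R (s y * f y) / s x) \<in> borel_measurable Hq"
    using r(1) by (auto simp: set_integrable_def)
  have H: "integrable Hq F" "integral\<^sup>L Hq F = schrodinger_dirichlet D q (\<lambda>y. s y * f y) x / s x"
    using integrable_cong_AE[OF _ m AE] integral_cong_AE[OF _ m AE] r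
    by (simp_all add: set_integrable_def set_lebesgue_integral_def)
  have L: "integrable (density lborel (\<lambda>y. ennreal (jump_density y))) F"
    "integral\<^sup>L (density lborel (\<lambda>y. ennreal (jump_density y))) F = green_potential D q (source f) x / s x"
    using integrable_jump_part[OF f] integral_jump_part[OF f]
    by (simp_all add: integrable_real_density integral_real_density jump_density_nonneg F_def)
  have W: "integrable weighted_measure F" "integral\<^sup>L weighted_measure F = dunkl_dirichlet Rp k D f x"
    unfolding weighted_measure_def dunkl_dirichlet_formula[OF f x] add_divide_distrib
    using integrable_plus_measure[OF _ H(1) L(1)] integral_plus_measure[OF _ H(1) L(1)] H L by simp_all
  have nn: "AE y in weighted_measure. 0 \<le> s y / s x" by (simp add: s_nonneg)
  show "set_integrable solution_measure (- D) f \<and> (LINT y:- D|solution_measure. f y) = dunkl_dirichlet Rp k D f x"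
    unfolding set_integrable_def set_lebesgue_integral_def solution_measure_def
    using W nn by (simp add: integrable_real_density integral_real_density F_def[abs_def])
qed

lemma prob_space_solution_measure: "prob_space solution_measure"
proof
  have r: "set_integrable solution_measure (- D) (\<lambda>_. 1 :: real)" "(LINT y:- D|solution_measure. (1 :: real)) = 1"
    using represents_solution_measure by (auto simp: represents_on_def dunkl_dirichlet_const)
  have "emeasure solution_measure (- D) < \<infinity>"
    using r(1) by (simp add: set_integrable_def integrable_indicator_iff)
  then have "emeasure solution_measure (- D) = 1"
    using r(2) by (simp add: set_lebesgue_integral_def emeasure_eq_ennreal_measure less_top)
  moreover have "emeasure solution_measure UNIV = emeasure solution_measure (- D) + emeasure solution_measure D"
    by (subst plus_emeasure) auto
  ultimately show "emeasure solution_measure (space solution_measure) = 1"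
    by (simp add: solution_measure_D)
qed

text \<open>The candidate satisfies the defining property, and \<open>represents_on_unique\<close>
  shows that no other measure does, which evaluates the definite description.\<close>

lemma dunkl_harmonic_measure_eq: "dunkl_harmonic_measure Rp k D x = solution_measure"
proof -
  interpret prob_space solution_measure by (rule prob_space_solution_measure)
  have "radon_measure_on (- D) solution_measure"
    by (simp add: radon_measure_on_def solution_measure_D emeasure_finite less_top[symmetric])
  moreover have "closed (- D)" using open_D by auto
  ultimately show ?thesis
    unfolding dunkl_harmonic_measure_def
    using represents_solution_measure by (intro the_equality) (auto intro: represents_on_unique)
qed

text \<open>Returns from the real Green function to \<open>G\<close>, which may be infinite at some
  points; the two densities agree almost everywhere, simultaneously for the finitely many
  roots.\<close>

lemma emeasure_weighted_measure:
  assumes [measurable]: "A \<in> sets borel"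
  shows "emeasure weighted_measure A = emeasure Hq A +
    (\<Sum>\<alpha>\<in>Rp. emeasure (density lborel (\<lambda>y. ennreal (jump \<alpha> y) * G x (reflection \<alpha> y))) A)"
proof -
  have "AE y in lborel. \<forall>\<alpha>\<in>Rp. G x (reflection \<alpha> y) = ennreal (green_real (reflection \<alpha> y))"
    by (rule AE_finite_allI[OF finite_Rp]) (rule AE_reflected_green)
  then have ae: "AE y in lborel. ennreal (jump_density y) * indicator A y
      = (\<Sum>\<alpha>\<in>Rp. ennreal (jump \<alpha> y) * G x (reflection \<alpha> y) * indicator A y)"
  proof eventually_elim
    case (elim y)
    then show ?case
      by (simp add: jump_density_def sum_distrib_right[symmetric] ennreal_mult jump_nonneg green_real_nonneg
        flip: sum_ennreal)
  qed
  have "emeasure (density lborel (\<lambda>y. ennreal (jump_density y))) A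
      = (\<integral>\<^sup>+y. (\<Sum>\<alpha>\<in>Rp. ennreal (jump \<alpha> y) * G x (reflection \<alpha> y) * indicator A y) \<partial>lborel)"
    using ae by (subst emeasure_density) (auto intro: nn_integral_cong_AE)
  also have "\<dots> = (\<Sum>\<alpha>\<in>Rp. emeasure (density lborel (\<lambda>y. ennreal (jump \<alpha> y) * G x (reflection \<alpha> y))) A)"
    by (subst nn_integral_sum) (auto simp: emeasure_density)
  finally show ?thesis
    by (simp add: weighted_measure_def emeasure_plus_measure)
qed

text \<open>The two densities are reciprocal wherever \<open>s\<close> is positive, and hence on
  \<open>carrier_set\<close>, whose complement is null.\<close>

lemma density_solution_measure:
  assumes [measurable]: "A \<in> sets borel"
  shows "emeasure (density solution_measure (\<lambda>y. ennreal (s x / s y))) A = emeasure weighted_measure A"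
proof -
  have "emeasure (density solution_measure (\<lambda>y. ennreal (s x / s y))) A
      = (\<integral>\<^sup>+y. ennreal (s y / s x) * (ennreal (s x / s y) * indicator A y) \<partial>weighted_measure)"
    unfolding solution_measure_def
    by (subst emeasure_density, simp, simp, subst nn_integral_density) simp_all
  also have "\<dots> = (\<integral>\<^sup>+y. indicator A y \<partial>weighted_measure)"
  proof (rule nn_integral_cong_AE)
    show "AE y in weighted_measure. ennreal (s y / s x) * (ennreal (s x / s y) * indicator A y) = indicator A y"
      using AE_weighted_measure
    proof eventually_elim
      case (elim y)
      have "0 < s y" "0 < s x" using s_pos_carrier_set[OF elim] s_pos x D_subset(2) by auto
      then have "ennreal (s y / s x) * ennreal (s x / s y) = 1"
        by (simp add: ennreal_mult[symmetric])
      then show ?case by (simp add: mult.assoc[symmetric])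
    qed
  qed
  finally show ?thesis by simp
qed

end

end

theorem corollary3:
  fixes R Rp D U :: "'a::euclidean_space set"
    and k q :: "'a \<Rightarrow> real"
    and Hq :: "'a \<Rightarrow> 'a measure"
    and G :: "'a \<Rightarrow> 'a \<Rightarrow> ennreal"
  assumes "root_system R"
    and "positive_subsystem R Rp"
    and "multiplicity_function R k"
    and "open D" and "bounded D" and "laplace_regular D"
    and "open U" and "connected U" and "closure D \<subseteq> U"
    and "U \<inter> (\<Union>\<alpha>\<in>Rp. root_hyperplane \<alpha>) = {}"
    and "\<And>x. x \<in> D \<Longrightarrow> q x = (\<Sum>\<alpha>\<in>Rp. (norm \<alpha> * k \<alpha> / (x \<bullet> \<alpha>))\<^sup>2)"
    and "\<And>x. x \<in> D \<Longrightarrow> schrodinger_harmonic_measure D q x (Hq x)"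
    and "green_function D q G"
  shows "\<forall>x\<in>D.
    prob_space (dunkl_harmonic_measure Rp k D x) \<and>
    emeasure (dunkl_harmonic_measure Rp k D x)
      (- (frontier D \<union> (\<Union>\<alpha>\<in>Rp. reflection \<alpha> ` D))) = 0 \<and>
    (\<forall>A\<in>sets borel.
      emeasure (density (dunkl_harmonic_measure Rp k D x)
        (\<lambda>y. ennreal (sqrt (dunkl_weight Rp k x) / sqrt (dunkl_weight Rp k y)))) A =
      emeasure (Hq x) A +
      (\<Sum>\<alpha>\<in>Rp. emeasure (density lborel
        (\<lambda>y. ennreal ((norm \<alpha>)\<^sup>2 * k \<alpha> / (y \<bullet> \<alpha>)\<^sup>2) * G x (reflection \<alpha> y))) A))"
proof -
  interpret chamber R Rp k D U
    by unfold_locales (use assms in auto)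
  interpret dunkl_dirichlet_problem R Rp k D U q G
    by unfold_locales (use assms in \<open>auto simp: potential_def\<close>)
  show ?thesis
  proof (intro ballI conjI)
    fix x assume x: "x \<in> D"
    note Hq = assms(12)[OF x]
    show "prob_space (dunkl_harmonic_measure Rp k D x)"
      unfolding dunkl_harmonic_measure_eq[OF x Hq] by (rule prob_space_solution_measure[OF x Hq])
    show "emeasure (dunkl_harmonic_measure Rp k D x) (- (frontier D \<union> (\<Union>\<alpha>\<in>Rp. reflection \<alpha> ` D))) = 0"
      unfolding dunkl_harmonic_measure_eq[OF x Hq]
      using solution_measure_carrier[OF x Hq] by (simp add: carrier_set_def)
    fix A :: "'a set" assume A: "A \<in> sets borel"
    show "emeasure (density (dunkl_harmonic_measure Rp k D x)
        (\<lambda>y. ennreal (sqrt (dunkl_weight Rp k x) / sqrt (dunkl_weight Rp k y)))) A =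
      emeasure (Hq x) A +
      (\<Sum>\<alpha>\<in>Rp. emeasure (density lborel
        (\<lambda>y. ennreal ((norm \<alpha>)\<^sup>2 * k \<alpha> / (y \<bullet> \<alpha>)\<^sup>2) * G x (reflection \<alpha> y))) A)"
      unfolding dunkl_harmonic_measure_eq[OF x Hq] s_def[symmetric] jump_def[symmetric]
        density_solution_measure[OF x Hq A] by (rule emeasure_weighted_measure[OF x Hq A])
  qed
qed

end
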